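(* Let $X$ be a geodesically complete $\mathrm{CAT}(0)$ space. If $X$ admits a proper cocompact isometric action of a group, then its Izeki–Nayatani invariant satisfies $\delta(X)<1$.
   Context: Every metric space is assumed to contain at least two points. Izeki–Nayatani invariant: let $(X,d)$ be a complete $\mathrm{CAT}(0)$ space. For a finitely supported probability measure $\mu$ on $X$, its barycenter $\mathrm{bar}(\mu)$ is the unique point $p\in X$ minimizing $p\mapsto\int_X d(p,q)^2\mu(dq)$. Let $\mathcal{P}(X)$ be the set of finitely supported probability measures on $X$ whose support contains at least two points. For $\mu\in\mathcal{P}(X)$, $\delta(\mu)\in[0,1]$ is the infimum of $$\frac{\|\int_X\phi(p)\mu(dp)\|^2}{\int_X\|\phi(p)\|^2\mu(dp)}$$ over all maps $\phi:\mathrm{Supp}(\mu)\to\mathcal{H}$ to a Hilbert space $\mathcal{H}$ with $\|\phi(p)\|=d(p,\mathrm{bar}(\mu))$ and $\|\phi(p)-\phi(q)\|\le d(p,q)$ for all $p,q\in\mathrm{Supp}(\mu)$. Then $\delta(X)=\sup_{\mu\in\mathcal{P}(X)}\delta(\mu)\in[0,1]$. Geodesic completeness: a geodesic is an isometric embedding of an interval; a local geodesic is a path $\gamma:I\to X$ such that every $t\in I$ has a neighborhood in $I$ on which $\gamma$ is a geodesic. A metric space $X$ is geodesically complete if it is complete and any local geodesic $\gamma:[0,a]\to X$ is a restriction of some local geodesic $\tilde\gamma:[0,b]\to X$ with $0<a<b$. Actions: an isometric action of a group $\Gamma$ on $X$ is cocompact if there is a compact $K\subset X$ with $X=\bigcup_{\gamma\in\Gamma}\gamma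 K$; it is proper if for each $p\in X$ there is $r>0$ such that $\{\gamma\in\Gamma:\gamma B(p,r)\cap B(p,r)\ne\emptyset\}$ is finite, where $B(p,r)$ is the open ball. *)

theory Defs
  imports "HOL-Analysis.Analysis" "HOL-Probability.Probability_Mass_Function" "HOL-Algebra.Group_Action"
begin

section \<open>The Hilbert space of square-summable real sequences\<close>

typedef ell2 = "{f :: nat \<Rightarrow> real. summable (\<lambda>n. (f n)\<^sup>2)}"
  morphisms coord Abs_ell2
  by (rule exI[of _ "\<lambda>_. 0"]) simp

setup_lifting type_definition_ell2

lemma summable_coord_sq: "summable (\<lambda>n. (coord x n)\<^sup>2)"
  using coord[of x] by simp

lemma summable_mult_sq:
  fixes f g :: "nat \<Rightarrow> real"
  assumes "summable (\<lambda>n. (f n)\<^sup>2)" "summable (\<lambda>n. (g n)\<^sup>2)"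
  shows "summable (\<lambda>n. f n * g n)"
proof (rule summable_comparison_test')
  show "summable (\<lambda>n. (f n)\<^sup>2 + (g n)\<^sup>2)"
    using assms by (rule summable_add)
  fix n
  have "2 * (\<bar>f n\<bar> * \<bar>g n\<bar>) \<le> (f n)\<^sup>2 + (g n)\<^sup>2"
    using sum_squares_bound[of "\<bar>f n\<bar>" "\<bar>g n\<bar>"] by simp
  moreover have "0 \<le> \<bar>f n\<bar> * \<bar>g n\<bar>" by simp
  ultimately show "norm (f n * g n) \<le> (f n)\<^sup>2 + (g n)\<^sup>2"
    unfolding real_norm_def abs_mult by linarith
qed

lemma summable_add_sq:
  fixes f g :: "nat \<Rightarrow> real"
  assumes "summable (\<lambda>n. (f n)\<^sup>2)" "summable (\<lambda>n. (g n)\<^sup>2)"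
  shows "summable (\<lambda>n. (f n + g n)\<^sup>2)"
proof -
  have "(\<lambda>n. (f n + g n)\<^sup>2) = (\<lambda>n. (f n)\<^sup>2 + (g n)\<^sup>2 + 2 * (f n * g n))"
    by (simp add: power2_sum mult.assoc)
  with assms show ?thesis
    by (auto intro!: summable_add summable_mult summable_mult_sq)
qed

lemma summable_coord_mult: "summable (\<lambda>n. coord x n * coord y n)"
  by (intro summable_mult_sq summable_coord_sq)

instantiation ell2 :: real_inner
begin

lift_definition zero_ell2 :: ell2 is "\<lambda>_. 0" by simp
lift_definition plus_ell2 :: "ell2 \<Rightarrow> ell2 \<Rightarrow> ell2" is "\<lambda>f g n. f n + g n"
  by (rule summable_add_sq)
lift_definition uminus_ell2 :: "ell2 \<Rightarrow> ell2" is "\<lambda>f n. - f n" by simp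
lift_definition minus_ell2 :: "ell2 \<Rightarrow> ell2 \<Rightarrow> ell2" is "\<lambda>f g n. f n - g n"
  subgoal for f g using summable_add_sq[of f "\<lambda>n. - g n"] by simp
  done
lift_definition scaleR_ell2 :: "real \<Rightarrow> ell2 \<Rightarrow> ell2" is "\<lambda>c f n. c * f n"
  by (simp add: power_mult_distrib summable_mult)
definition inner_ell2 :: "ell2 \<Rightarrow> ell2 \<Rightarrow> real" where
  "inner_ell2 x y = (\<Sum>n. coord x n * coord y n)"
definition norm_ell2 :: "ell2 \<Rightarrow> real" where
  "norm_ell2 x = sqrt (inner x x)"
definition dist_ell2 :: "ell2 \<Rightarrow> ell2 \<Rightarrow> real" where
  "dist_ell2 x y = norm (x - y)"
definition sgn_ell2 :: "ell2 \<Rightarrow> ell2" where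
  "sgn_ell2 x = inverse (norm x) *\<^sub>R x"
definition uniformity_ell2 :: "(ell2 \<times> ell2) filter" where
  "uniformity_ell2 = (INF e\<in>{0<..}. principal {(x, y). dist x y < e})"
definition open_ell2 :: "ell2 set \<Rightarrow> bool" where
  "open_ell2 U \<longleftrightarrow> (\<forall>x\<in>U. \<forall>\<^sub>F (x', y) in uniformity. x' = x \<longrightarrow> y \<in> U)"

instance
proof
  fix x y z :: ell2 and a b :: real
  show "x + y + z = x + (y + z)" "x + y = y + x" "0 + x = x" "- x + x = 0" "x - y = x + - y"
    "a *\<^sub>R (x + y) = a *\<^sub>R x + a *\<^sub>R y" "(a + b) *\<^sub>R x = a *\<^sub>R x + b *\<^sub>R x"
    "a *\<^sub>R b *\<^sub>R x = (a * b) *\<^sub>R x" "1 *\<^sub>R x = x"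
    by (transfer; simp add: fun_eq_iff algebra_simps)+
  show "dist x y = norm (x - y)" by (rule dist_ell2_def)
  show "sgn x = inverse (norm x) *\<^sub>R x" by (rule sgn_ell2_def)
  show "uniformity = (INF e\<in>{0<..}. principal {(x::ell2, y). dist x y < e})"
    by (rule uniformity_ell2_def)
  show "open U \<longleftrightarrow> (\<forall>x\<in>U. \<forall>\<^sub>F (x', y) in uniformity. x' = x \<longrightarrow> y \<in> U)" for U :: "ell2 set"
    by (rule open_ell2_def)
  show "inner x y = inner y x" by (simp add: inner_ell2_def mult.commute)
  show "inner (x + y) z = inner x z + inner y z"
    by (simp add: inner_ell2_def plus_ell2.rep_eq distrib_right suminf_add summable_coord_mult)
  show "inner (a *\<^sub>R x) y = a * inner x y"
    by (simp add: inner_ell2_def scaleR_ell2.rep_eq mult.assoc suminf_mult summable_coord_mult)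
  show "0 \<le> inner x x"
    by (simp add: inner_ell2_def suminf_nonneg summable_coord_mult)
  have "inner x x = 0 \<longleftrightarrow> (\<forall>n. coord x n * coord x n = 0)"
    unfolding inner_ell2_def by (rule suminf_eq_zero_iff) (simp_all add: summable_coord_mult)
  also have "\<dots> \<longleftrightarrow> x = 0"
    by (simp add: coord_inject[symmetric] zero_ell2.rep_eq fun_eq_iff)
  finally show "inner x x = 0 \<longleftrightarrow> x = 0" .
  show "norm x = sqrt (inner x x)" by (rule norm_ell2_def)
qed

end

lemma norm_ell2_sq: "(norm (x::ell2))\<^sup>2 = (\<Sum>n. (coord x n)\<^sup>2)"
  unfolding power2_norm_eq_inner inner_ell2_def by (simp add: power2_eq_square)

lemma sum_coord_sq_le: "(\<Sum>i<n. (coord x i)\<^sup>2) \<le> (norm x)\<^sup>2"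
  unfolding norm_ell2_sq by (rule sum_le_suminf) (auto simp: summable_coord_sq)

lemma abs_coord_le_norm: "\<bar>coord x i\<bar> \<le> norm x"
proof -
  have "(coord x i)\<^sup>2 \<le> (\<Sum>i<Suc i. (coord x i)\<^sup>2)"
    by (rule member_le_sum) auto
  also have "\<dots> \<le> (norm x)\<^sup>2" by (rule sum_coord_sq_le)
  finally show ?thesis by (simp add: abs_le_square_iff[of _ "norm x", simplified])
qed

instance ell2 :: complete_space
proof
  fix X :: "nat \<Rightarrow> ell2"
  assume X: "Cauchy X"
  have "Cauchy (\<lambda>m. coord (X m) i)" for i
  proof (rule metric_CauchyI)
    fix e :: real assume "0 < e"
    from metric_CauchyD[OF X this]
    obtain M where M: "\<forall>m\<ge>M. \<forall>n\<ge>M. dist (X m) (X n) < e" ..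
    have "dist (coord (X m) i) (coord (X n) i) \<le> dist (X m) (X n)" for m n
      using abs_coord_le_norm[of "X m - X n" i]
      by (simp add: dist_real_def dist_norm minus_ell2.rep_eq)
    with M have "\<forall>m\<ge>M. \<forall>n\<ge>M. dist (coord (X m) i) (coord (X n) i) < e"
      by (blast intro: le_less_trans)
    then show "\<exists>M. \<forall>m\<ge>M. \<forall>n\<ge>M. dist (coord (X m) i) (coord (X n) i) < e" ..
  qed
  then have "\<forall>i. \<exists>l. (\<lambda>m. coord (X m) i) \<longlonglongrightarrow> l"
    unfolding Cauchy_convergent_iff convergent_def by blast
  then obtain f where f: "\<And>i. (\<lambda>m. coord (X m) i) \<longlonglongrightarrow> f i" by metis
  have bound: "(\<Sum>i<n. (coord (X m) i - f i)\<^sup>2) \<le> e\<^sup>2"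
    if "\<forall>k\<ge>M. dist (X m) (X k) < e" for e m M n
  proof (rule LIMSEQ_le_const2)
    show "(\<lambda>k. \<Sum>i<n. (coord (X m) i - coord (X k) i)\<^sup>2) \<longlonglongrightarrow> (\<Sum>i<n. (coord (X m) i - f i)\<^sup>2)"
      by (intro tendsto_intros f)
    show "\<exists>N. \<forall>k\<ge>N. (\<Sum>i<n. (coord (X m) i - coord (X k) i)\<^sup>2) \<le> e\<^sup>2"
    proof (intro exI allI impI)
      fix k assume "M \<le> k"
      then have "norm (X m - X k) < e" using that by (simp add: dist_norm)
      then have "(norm (X m - X k))\<^sup>2 \<le> e\<^sup>2" by (intro power_mono) auto
      with sum_coord_sq_le[of "X m - X k" n]
      show "(\<Sum>i<n. (coord (X m) i - coord (X k) i)\<^sup>2) \<le> e\<^sup>2"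
        by (simp add: minus_ell2.rep_eq)
    qed
  qed
  have summ: "summable (\<lambda>i. (coord (X m) i - f i)\<^sup>2)"
    if "\<forall>k\<ge>M. dist (X m) (X k) < e" for e m M
    using bound[OF that] by (intro summableI_nonneg_bounded[where x = "e\<^sup>2"]) auto
  obtain M1 where M1: "\<forall>m\<ge>M1. \<forall>n\<ge>M1. dist (X m) (X n) < 1"
    using metric_CauchyD[OF X zero_less_one] ..
  then have "\<forall>k\<ge>M1. dist (X M1) (X k) < 1" by blast
  then have "summable (\<lambda>i. (- (coord (X M1) i - f i))\<^sup>2)"
    unfolding power2_minus by (rule summ)
  from summable_add_sq[OF summable_coord_sq this, of "X M1"]
  have "summable (\<lambda>i. (f i)\<^sup>2)" by simp
  then have L: "coord (Abs_ell2 f) = f" by (simp add: Abs_ell2_inverse)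
  define L where "L = Abs_ell2 f"
  note L = L[folded L_def]
  have "X \<longlonglongrightarrow> L"
  proof (rule metric_LIMSEQ_I)
    fix r :: real assume "0 < r"
    then have "0 < r/2" by simp
    from metric_CauchyD[OF X this]
    obtain M where M: "\<forall>m\<ge>M. \<forall>n\<ge>M. dist (X m) (X n) < r/2" ..
    show "\<exists>no. \<forall>n\<ge>no. dist (X n) L < r"
    proof (intro exI allI impI)
      fix m assume "M \<le> m"
      then have m: "\<forall>k\<ge>M. dist (X m) (X k) < r/2" using M by blast
      have "(norm (X m - L))\<^sup>2 \<le> (r/2)\<^sup>2"
        unfolding norm_ell2_sq minus_ell2.rep_eq L by (rule suminf_le_const[OF summ[OF m] bound[OF m]])
      then have "norm (X m - L) \<le> r/2" by (rule power2_le_imp_le) (use \<open>0 < r\<close> in simp)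
      then show "dist (X m) L < r" using \<open>0 < r\<close> by (simp add: dist_norm)
    qed
  qed
  then show "convergent X" by (auto simp: convergent_def)
qed

text \<open>
  Finite configurations in an arbitrary real inner product space are realised in \<open>ell2\<close>.
\<close>

lemma finite_orthogonal_expansion:
  fixes C :: "'h::real_inner set"
  assumes "finite C" "pairwise orthogonal C" "v \<in> span C"
  shows "inner v w = (\<Sum>c\<in>C. (inner v c / norm c) * (inner w c / norm c))"
proof -
  have vc: "v = (\<Sum>c\<in>C. (inner v c / (inner c c)) *\<^sub>R c)"
  proof -
    obtain u where u: "v = (\<Sum>c\<in>C. u c *\<^sub>R c)"
      using assms(1,3) by (auto simp: span_finite)
    have "inner v d = u d * inner d d" if "d \<in> C" for d
    proof -
      have "inner v d = (\<Sum>c\<in>C. u c * inner c d)"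
        by (simp add: u inner_sum_left)
      also have "\<dots> = (\<Sum>c\<in>C. if c = d then u d * inner d d else 0)"
        using assms(2) that by (intro sum.cong) (auto simp: pairwise_def orthogonal_def)
      also have "\<dots> = u d * inner d d" using assms(1) that by simp
      finally show ?thesis .
    qed
    then have "(inner v c / inner c c) *\<^sub>R c = u c *\<^sub>R c" if "c \<in> C" for c
      using that by (cases "c = 0") auto
    then have "(\<Sum>c\<in>C. (inner v c / inner c c) *\<^sub>R c) = (\<Sum>c\<in>C. u c *\<^sub>R c)"
      by (rule sum.cong[OF refl])
    with u show ?thesis by simp
  qed
  have "inner v w = inner (\<Sum>c\<in>C. (inner v c / (inner c c)) *\<^sub>R c) w"
    by (rule arg_cong[OF vc])
  also have "\<dots> = (\<Sum>c\<in>C. (inner v c / (inner c c)) * inner w c)"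
    by (simp only: inner_sum_left inner_scaleR_left inner_commute[of w])
  also have "\<dots> = (\<Sum>c\<in>C. (inner v c / norm c) * (inner w c / norm c))"
    by (intro sum.cong) (auto simp: dot_square_norm power2_eq_square)
  finally show ?thesis .
qed

lemma ell2_embedding:
  fixes \<phi> :: "'a \<Rightarrow> 'h::real_inner"
  assumes "finite S"
  shows "\<exists>\<psi> :: 'a \<Rightarrow> ell2. \<forall>p\<in>S. \<forall>q\<in>S. inner (\<psi> p) (\<psi> q) = inner (\<phi> p) (\<phi> q)"
proof -
  obtain C where C: "finite C" "span C = span (\<phi> ` S)" "pairwise orthogonal C"
    using basis_orthogonal[of "\<phi> ` S"] assms by auto
  obtain e where e: "bij_betw e {..<card C} C"
    using C(1) ex_bij_betw_nat_finite by (metis atLeast0LessThan)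
  define F where "F p n = (if n < card C then inner (\<phi> p) (e n) / norm (e n) else 0)" for p n
  have "summable (\<lambda>n. (F p n)\<^sup>2)" for p
    by (rule summable_finite[of "{..<card C}"]) (auto simp: F_def)
  then have coordF: "coord (Abs_ell2 (F p)) = F p" for p
    by (simp add: Abs_ell2_inverse)
  have "inner (Abs_ell2 (F p)) (Abs_ell2 (F q)) = inner (\<phi> p) (\<phi> q)" if "p \<in> S" "q \<in> S" for p q
  proof -
    have "inner (Abs_ell2 (F p)) (Abs_ell2 (F q)) = (\<Sum>n. F p n * F q n)"
      by (simp add: inner_ell2_def coordF)
    also have "\<dots> = (\<Sum>n<card C. F p n * F q n)"
      by (rule suminf_finite) (auto simp: F_def)
    also have "\<dots> = (\<Sum>n<card C. (inner (\<phi> p) (e n) / norm (e n)) * (inner (\<phi> q) (e n) / norm (e n)))"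
      by (simp add: F_def)
    also have "\<dots> = (\<Sum>c\<in>C. (inner (\<phi> p) c / norm c) * (inner (\<phi> q) c / norm c))"
      using e by (rule sum.reindex_bij_betw)
    also have "\<dots> = inner (\<phi> p) (\<phi> q)"
      using C that by (intro finite_orthogonal_expansion[symmetric]) (auto intro: span_base)
    finally show ?thesis .
  qed
  then show ?thesis by (intro exI[of _ "\<lambda>p. Abs_ell2 (F p)"] ballI)
qed

section \<open>Geodesics and CAT(0) spaces\<close>

definition geodesic_on :: "real set \<Rightarrow> (real \<Rightarrow> 'a::metric_space) \<Rightarrow> bool" where
  "geodesic_on I \<gamma> \<longleftrightarrow> (\<forall>s\<in>I. \<forall>t\<in>I. dist (\<gamma> s) (\<gamma> t) = \<bar>s - t\<bar>)"

definition geodesic_segment :: "'a::metric_space \<Rightarrow> 'a \<Rightarrow> 'a set \<Rightarrow> bool" where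
  "geodesic_segment x y S \<longleftrightarrow>
     (\<exists>\<gamma>. geodesic_on {0..dist x y} \<gamma> \<and> \<gamma> 0 = x \<and> \<gamma> (dist x y) = y \<and> S = \<gamma> ` {0..dist x y})"

text \<open>
  In the comparison inequality the two sides are the ones issuing from the vertex \<open>x\<close>:
  two distinct sides of a triangle always share a vertex, the labelling of the vertices is
  arbitrary, and for two points on one side the inequality is an equality.
\<close>

definition CAT0 :: "'a::metric_space itself \<Rightarrow> bool" where
  "CAT0 _ \<longleftrightarrow>
     (\<forall>x y :: 'a. \<exists>S. geodesic_segment x y S) \<and>
     (\<forall>(x :: 'a) y z S T U. \<forall>x' y' z' :: real ^ 2.
        geodesic_segment x y S \<and> geodesic_segment x z T \<and> geodesic_segment y z U \<and>
        dist x' y' = dist x y \<and> dist x' z' = dist x z \<and> dist y' z' = dist y z \<longrightarrow>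
        (\<forall>p\<in>S. \<forall>q\<in>T. \<forall>p'\<in>closed_segment x' y'. \<forall>q'\<in>closed_segment x' z'.
           dist x' p' = dist x p \<and> dist x' q' = dist x q \<longrightarrow> dist p q \<le> dist p' q'))"

definition local_geodesic_on :: "real set \<Rightarrow> (real \<Rightarrow> 'a::metric_space) \<Rightarrow> bool" where
  "local_geodesic_on I \<gamma> \<longleftrightarrow> (\<forall>t\<in>I. \<exists>e>0. geodesic_on (I \<inter> ball t e) \<gamma>)"

definition geodesically_complete :: "'a::metric_space itself \<Rightarrow> bool" where
  "geodesically_complete _ \<longleftrightarrow>
     complete (UNIV :: 'a set) \<and>
     (\<forall>a>0. \<forall>\<gamma> :: real \<Rightarrow> 'a. local_geodesic_on {0..a} \<gamma> \<longrightarrow>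
        (\<exists>b>a. \<exists>\<gamma>'. local_geodesic_on {0..b} \<gamma>' \<and> (\<forall>t\<in>{0..a}. \<gamma>' t = \<gamma> t)))"

section \<open>The Izeki--Nayatani invariant\<close>

text \<open>
  The library integral with respect to a \<open>pmf\<close> takes values in second-countable Banach spaces;
  for finitely supported measures the following sum makes sense in every real vector space.
\<close>

definition fs_integral :: "'a pmf \<Rightarrow> ('a \<Rightarrow> 'b::real_vector) \<Rightarrow> 'b" where
  "fs_integral \<mu> f = (\<Sum>p\<in>set_pmf \<mu>. pmf \<mu> p *\<^sub>R f p)"

lemma fs_integral_eq_expectation:
  fixes f :: "'a \<Rightarrow> 'b::{banach, second_countable_topology}"
  assumes "finite (set_pmf \<mu>)"
  shows "fs_integral \<mu> f = measure_pmf.expectation \<mu> f"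
  unfolding fs_integral_def using assms by (intro integral_measure_pmf[symmetric]) auto

definition barycenter :: "'a::metric_space pmf \<Rightarrow> 'a" where
  "barycenter \<mu> = (THE p. is_arg_min (\<lambda>p. fs_integral \<mu> (\<lambda>q. (dist p q)\<^sup>2)) (\<lambda>_. True) p)"

definition fs_measures :: "'a pmf set" where
  "fs_measures = {\<mu>. finite (set_pmf \<mu>) \<and> card (set_pmf \<mu>) \<ge> 2}"

definition IN_admissible :: "'a::metric_space pmf \<Rightarrow> ('a \<Rightarrow> 'h::real_inner) \<Rightarrow> bool" where
  "IN_admissible \<mu> \<phi> \<longleftrightarrow>
     (\<forall>p\<in>set_pmf \<mu>. norm (\<phi> p) = dist p (barycenter \<mu>)) \<and>
     (\<forall>p\<in>set_pmf \<mu>. \<forall>q\<in>set_pmf \<mu>. norm (\<phi> p - \<phi> q) \<le> dist p q)"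

definition IN_ratio :: "'a pmf \<Rightarrow> ('a \<Rightarrow> 'h::real_inner) \<Rightarrow> real" where
  "IN_ratio \<mu> \<phi> = (norm (fs_integral \<mu> \<phi>))\<^sup>2 / fs_integral \<mu> (\<lambda>p. (norm (\<phi> p))\<^sup>2)"

text \<open>
  HOL cannot quantify over all Hilbert spaces inside a formula. As the support is finite,
  letting \<open>\<phi>\<close> range over the maps into \<open>ell2\<close> yields all possible values of the ratio;
  see \<open>IN_ratio_ell2\<close> below.
\<close>

definition IN_delta_measure :: "'a::metric_space pmf \<Rightarrow> real" where
  "IN_delta_measure \<mu> = Inf {IN_ratio \<mu> \<phi> | \<phi> :: 'a \<Rightarrow> ell2. IN_admissible \<mu> \<phi>}"

definition IN_delta :: "'a::metric_space itself \<Rightarrow> real" where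
  "IN_delta _ = Sup (IN_delta_measure ` (fs_measures :: 'a pmf set))"

lemma IN_ratio_ell2:
  fixes \<phi> :: "'a::metric_space \<Rightarrow> 'h::real_inner"
  assumes "finite (set_pmf \<mu>)" "IN_admissible \<mu> \<phi>"
  shows "\<exists>\<psi> :: 'a \<Rightarrow> ell2. IN_admissible \<mu> \<psi> \<and> IN_ratio \<mu> \<psi> = IN_ratio \<mu> \<phi>"
proof -
  let ?S = "set_pmf \<mu>"
  obtain \<psi> :: "'a \<Rightarrow> ell2" where
    \<psi>: "\<And>p q. p \<in> ?S \<Longrightarrow> q \<in> ?S \<Longrightarrow> inner (\<psi> p) (\<psi> q) = inner (\<phi> p) (\<phi> q)"
    using ell2_embedding[OF assms(1), of \<phi>] by blast
  have n: "norm (\<psi> p) = norm (\<phi> p)" if "p \<in> ?S" for p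
    using \<psi> that by (simp add: norm_eq_sqrt_inner)
  have d: "norm (\<psi> p - \<psi> q) = norm (\<phi> p - \<phi> q)" if "p \<in> ?S" "q \<in> ?S" for p q
    using \<psi> that by (simp add: norm_eq_sqrt_inner inner_diff_left inner_diff_right)
  have i: "(norm (fs_integral \<mu> \<psi>))\<^sup>2 = (norm (fs_integral \<mu> \<phi>))\<^sup>2"
    unfolding power2_norm_eq_inner fs_integral_def inner_sum_left inner_sum_right
    by (intro sum.cong refl) (simp add: \<psi>)
  have "fs_integral \<mu> (\<lambda>p. (norm (\<psi> p))\<^sup>2) = fs_integral \<mu> (\<lambda>p. (norm (\<phi> p))\<^sup>2)"
    unfolding fs_integral_def by (intro sum.cong refl) (simp add: n)
  with i n d assms(2) show ?thesis
    by (intro exI[of _ \<psi>]) (auto simp: IN_admissible_def IN_ratio_def)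
qed

section \<open>Group actions\<close>

definition isometric_action ::
    "('g, 'm) monoid_scheme \<Rightarrow> ('g \<Rightarrow> 'a::metric_space \<Rightarrow> 'a) \<Rightarrow> bool" where
  "isometric_action G \<alpha> \<longleftrightarrow>
     group_action G UNIV \<alpha> \<and> (\<forall>g\<in>carrier G. \<forall>x y. dist (\<alpha> g x) (\<alpha> g y) = dist x y)"

definition cocompact_action ::
    "('g, 'm) monoid_scheme \<Rightarrow> ('g \<Rightarrow> 'a::metric_space \<Rightarrow> 'a) \<Rightarrow> bool" where
  "cocompact_action G \<alpha> \<longleftrightarrow> (\<exists>K. compact K \<and> UNIV = (\<Union>g\<in>carrier G. \<alpha> g ` K))"

definition proper_action ::
    "('g, 'm) monoid_scheme \<Rightarrow> ('g \<Rightarrow> 'a::metric_space \<Rightarrow> 'a) \<Rightarrow> bool" where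
  "proper_action G \<alpha> \<longleftrightarrow>
     (\<forall>p. \<exists>r>0. finite {g \<in> carrier G. \<alpha> g ` ball p r \<inter> ball p r \<noteq> {}})"

end

theory Submission
  imports Defs
begin

text \<open>
  Let \<open>\<mu>\<close> be a finitely supported measure with barycenter \<open>p\<close>. Write \<open>a q = dist p q\<close>, and give the point
  \<open>q\<close> of the support the weight \<open>w q = \<mu> q * a q\<close>; let \<open>D\<close> be the total weight. A map of the
  form \<open>\<phi> q = a q *\<^sub>R cis (\<theta> q)\<close> into the plane has the prescribed norms, and by Jensen
  its ratio is at most \<open>(norm (\<Sum> w q *\<^sub>R cis (\<theta> q)) / D)\<^sup>2\<close>. So it suffices to find angles
  \<open>\<theta>\<close> for which \<open>\<phi>\<close> is non-expanding and for which a definite proportion of the weight points in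
  different directions, with a proportion independent of \<open>\<mu>\<close>.

  Take a small \<open>t > 0\<close>, let \<open>y q\<close> be the point at distance \<open>t\<close> from \<open>p\<close> on the geodesic from \<open>p\<close> to
  \<open>q\<close>, choose one point \<open>u\<close> of the support, and put \<open>\<theta> q = dist (y u) (y q) / t\<close>. This is a chord
  version of the angle at \<open>p\<close> between \<open>u\<close> and \<open>q\<close>. Because \<open>dist\<close> obeys the triangle inequality and
  \<open>1 - cos x \<le> x\<^sup>2 / 2\<close>, the CAT(0) inequality at \<open>p\<close> makes \<open>\<phi>\<close> non-expanding
  (\<open>cone_map_nonexpanding\<close>).

  Two facts keep the angles apart. First, \<open>p\<close> minimizes the mean square distance, so moving from
  \<open>p\<close> to \<open>y u\<close> does not decrease it; for small \<open>t\<close> this says that the weighted mean of \<open>\<theta>\<close> is nearly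
  at least \<open>1\<close>. Second, \<open>u\<close> can be chosen so that a proportion \<open>1 / N\<close> of the weight has
  \<open>\<theta> \<le> 1/4\<close>: geodesic completeness prolongs every geodesic issuing from \<open>p\<close> to a fixed length \<open>r\<close>,
  the endpoints lie in a ball that is covered by \<open>N\<close> balls of radius \<open>r / 8\<close>, and one of these
  balls receives at least the average weight. Then \<open>norm (\<Sum> w q *\<^sub>R cis (\<theta> q))\<close> falls short of
  \<open>D\<close> by a definite factor (\<open>cis_average_le\<close>), and \<open>IN_delta_measure_le\<close> bounds the invariant of
  \<open>\<mu>\<close> by \<open>1 - 1 / (12 * N)\<close>. A proper cocompact action supplies \<open>r\<close> and \<open>N\<close> uniformly in \<open>p\<close>
  (\<open>uniform_covers\<close>).
\<close>

section \<open>The CAT(0) inequality for points lying between two others\<close>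

text \<open>
  In a geodesic space this says that \<open>p\<close> lies on some geodesic segment from \<open>x\<close> to \<open>y\<close>. Working
  with the equation avoids carrying parametrized geodesics through the later arguments.
\<close>

definition metric_between :: "'a::metric_space \<Rightarrow> 'a \<Rightarrow> 'a \<Rightarrow> bool" where
  "metric_between x p y \<longleftrightarrow> dist x p + dist p y = dist x y"

lemma metric_between_endpoint [simp]: "metric_between x y y"
  by (simp add: metric_between_def)

lemma metric_between_le: "metric_between x p y \<Longrightarrow> dist x p \<le> dist x y"
  unfolding metric_between_def using zero_le_dist[of p y] by linarith

lemma metric_between_trans: "metric_between x p q \<Longrightarrow> metric_between x q y \<Longrightarrow> metric_between x p y"
  unfolding metric_between_def using dist_triangle[of p y q] dist_triangle[of x y p] by linarith

lemma geodesic_metric_between: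
  assumes "geodesic_on {0..L} \<gamma>" "0 \<le> s" "s \<le> L"
  shows "dist (\<gamma> 0) (\<gamma> s) = s" "dist (\<gamma> s) (\<gamma> L) = L - s" "dist (\<gamma> 0) (\<gamma> L) = L"
  using assms by (auto simp: geodesic_on_def)

lemma CAT0_geodesic:
  assumes "CAT0 TYPE('a::metric_space)"
  obtains \<gamma> where "geodesic_on {0..dist x y} \<gamma>" "\<gamma> 0 = (x::'a)" "\<gamma> (dist x y) = y"
proof -
  have "\<exists>S. geodesic_segment x y S" using assms by (simp add: CAT0_def)
  then show ?thesis unfolding geodesic_segment_def by (elim exE conjE) (rule that)
qed

lemma CAT0_point_at:
  fixes x y :: "'a::metric_space"
  assumes "CAT0 TYPE('a)" "0 \<le> s" "s \<le> dist x y"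
  obtains p where "metric_between x p y" "dist x p = s"
proof -
  obtain \<gamma> where g: "geodesic_on {0..dist x y} \<gamma>" "\<gamma> 0 = x" "\<gamma> (dist x y) = y"
    using CAT0_geodesic[OF assms(1)] .
  show ?thesis
    using geodesic_metric_between[OF g(1) assms(2,3)] g(2,3) by (intro that[of "\<gamma> s"]) (auto simp: metric_between_def)
qed

text \<open>
  A geodesic from \<open>x\<close> to \<open>p\<close> followed by one from \<open>p\<close> to \<open>y\<close> has length \<open>dist x y\<close>, so the triangle
  inequality leaves no room for a shortcut and the concatenation is itself a geodesic.
\<close>

lemma metric_between_imp_on_segment:
  fixes x p y :: "'a::metric_space"
  assumes "CAT0 TYPE('a)" "metric_between x p y"
  shows "\<exists>S. geodesic_segment x y S \<and> p \<in> S"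
proof -
  define k where "k = dist x p"
  define L where "L = dist x y"
  have kL: "0 \<le> k" "k \<le> L" "dist p y = L - k"
    using assms(2) metric_between_le[OF assms(2)] by (auto simp: k_def L_def metric_between_def)
  obtain f where f: "geodesic_on {0..k} f" "f 0 = x" "f k = p"
    using CAT0_geodesic[OF assms(1)] unfolding k_def .
  obtain h where h: "geodesic_on {0..L - k} h" "h 0 = p" "h (L - k) = y"
    using CAT0_geodesic[OF assms(1), of p y] unfolding kL(3) .
  define \<gamma> where "\<gamma> s = (if s \<le> k then f s else h (s - k))" for s
  have mixed: "dist (f s) (h (t - k)) = t - s" if "0 \<le> s" "s \<le> k" "k \<le> t" "t \<le> L" for s t
  proof -
    have "dist (f s) p = k - s" "dist x (f s) = s"
      using geodesic_metric_between[OF f(1) that(1,2)] f by auto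
    moreover have "dist p (h (t - k)) = t - k" "dist (h (t - k)) y = L - t"
      using geodesic_metric_between[OF h(1), of "t - k"] h that by auto
    ultimately show ?thesis
      using dist_triangle[of "f s" "h (t - k)" p] dist_triangle[of x y "f s"]
        dist_triangle[of "f s" y "h (t - k)"] L_def by linarith
  qed
  have dir: "dist (\<gamma> s) (\<gamma> t) = t - s" if "0 \<le> s" "s \<le> t" "t \<le> L" for s t
  proof -
    consider "t \<le> k" | "s \<le> k" "k < t" | "k < s" by linarith
    then show ?thesis
    proof cases
      case 1
      then show ?thesis using f(1) that by (simp add: \<gamma>_def geodesic_on_def)
    next
      case 2
      then show ?thesis using mixed[of s t] that by (simp add: \<gamma>_def)
    next
      case 3
      then show ?thesis using h(1) that by (simp add: \<gamma>_def geodesic_on_def)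
    qed
  qed
  have "geodesic_on {0..L} \<gamma>"
    unfolding geodesic_on_def
  proof (intro ballI)
    fix s t assume "s \<in> {0..L}" "t \<in> {0..L}"
    then show "dist (\<gamma> s) (\<gamma> t) = \<bar>s - t\<bar>"
      using dir[of s t] dir[of t s] by (cases "s \<le> t") (auto simp: dist_commute)
  qed
  moreover have "\<gamma> 0 = x" "\<gamma> k = p"
    using f kL by (auto simp: \<gamma>_def)
  moreover have "\<gamma> L = y"
    using f(3) h(2,3) kL by (cases "k = L") (auto simp: \<gamma>_def)
  ultimately have "geodesic_segment x y (\<gamma> ` {0..L})"
    unfolding geodesic_segment_def L_def by blast
  moreover have "p \<in> \<gamma> ` {0..L}" using \<open>\<gamma> k = p\<close> kL by force
  ultimately show ?thesis by blast
qed

text \<open>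
  The law of cosines dictates the cosine of the angle at the origin; the triangle inequalities say
  exactly that it lies between \<open>-1\<close> and \<open>1\<close>.
\<close>

lemma comparison_triangle:
  fixes a b d :: real
  assumes "0 < a" "0 < b" "\<bar>a - b\<bar> \<le> d" "d \<le> a + b"
  obtains y z :: "real ^ 2" where "norm y = a" "norm z = b" "dist y z = d"
proof -
  define c where "c = (a\<^sup>2 + b\<^sup>2 - d\<^sup>2) / (2 * a * b)"
  have d0: "0 \<le> d" using assms(3) by linarith
  have 1: "(a - b)\<^sup>2 \<le> d\<^sup>2" using assms(3) d0 by (simp add: abs_le_square_iff[symmetric])
  have 2: "d\<^sup>2 \<le> (a + b)\<^sup>2" using assms(4) d0 by (intro power_mono)
  have "c \<le> 1" "-1 \<le> c"
    using 1 2 assms(1,2) by (auto simp: c_def field_simps power2_eq_square)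
  then have c2: "c\<^sup>2 \<le> 1" by (simp add: abs_square_le_1)
  define y :: "real ^ 2" where "y = vector [a, 0]"
  define z :: "real ^ 2" where "z = vector [b * c, b * sqrt (1 - c\<^sup>2)]"
  have cc: "2 * a * b * c = a\<^sup>2 + b\<^sup>2 - d\<^sup>2" using assms by (simp add: c_def)
  have "norm y = a" using assms by (simp add: y_def norm_vec_def L2_set_def sum_2)
  moreover have "norm z = b"
    using assms c2 by (simp add: z_def norm_vec_def L2_set_def sum_2 power_mult_distrib algebra_simps)
  moreover have "dist y z = d"
  proof -
    have "(a - b * c)\<^sup>2 + (b * sqrt (1 - c\<^sup>2))\<^sup>2 = d\<^sup>2"
      using c2 cc by (simp add: power_mult_distrib power2_diff algebra_simps)
    then show ?thesis
      using d0 by (simp add: y_def z_def dist_vec_def L2_set_def sum_2 dist_real_def)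
  qed
  ultimately show ?thesis by (rule that)
qed

lemma CAT0_comparison:
  fixes x y z :: "'a::metric_space" and x' y' z' :: "real ^ 2"
  assumes "CAT0 TYPE('a)" "geodesic_segment x y S" "geodesic_segment x z T"
    and "dist x' y' = dist x y" "dist x' z' = dist x z" "dist y' z' = dist y z"
    and "p \<in> S" "q \<in> T" "p' \<in> closed_segment x' y'" "q' \<in> closed_segment x' z'"
    and "dist x' p' = dist x p" "dist x' q' = dist x q"
  shows "dist p q \<le> dist p' q'"
proof -
  obtain U where "geodesic_segment y z U"
    using assms(1)[unfolded CAT0_def, THEN conjunct1, rule_format, of y z] ..
  show ?thesis
    by (rule assms(1)[unfolded CAT0_def, THEN conjunct2, rule_format,
          where x = x and y = y and z = z and S = S and T = T and U = U
            and x' = x' and y' = y' and z' = z'])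
      (use assms(2-) \<open>geodesic_segment y z U\<close> in simp_all)
qed

text \<open>
  In a Euclidean triangle with vertex \<open>x\<close> both sides agree: divided by the product of the four distances
  from \<open>x\<close>, each becomes twice the difference of \<open>1\<close> and the cosine of the angle at \<open>x\<close>. So the inequality says that the
  comparison angle at \<open>x\<close> does not increase when the endpoints move towards \<open>x\<close>. The form
  without denominators also covers degenerate triangles.
\<close>

lemma CAT0_inequality:
  fixes x y z p q :: "'a::metric_space"
  assumes "CAT0 TYPE('a)" "metric_between x p y" "metric_between x q z"
  shows "dist x y * dist x z * ((dist p q)\<^sup>2 - (dist x p - dist x q)\<^sup>2)
    \<le> dist x p * dist x q * ((dist y z)\<^sup>2 - (dist x y - dist x z)\<^sup>2)"
proof (cases "x = y \<or> x = z")
  case True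
  then show ?thesis using metric_between_le[OF assms(2)] metric_between_le[OF assms(3)] by auto
next
  case False
  define a b d s t where "a = dist x y" "b = dist x z" "d = dist y z" "s = dist x p" "t = dist x q"
  note defs = this
  have pos: "0 < a" "0 < b" "0 \<le> s" "s \<le> a" "0 \<le> t" "t \<le> b"
    using False metric_between_le[OF assms(2)] metric_between_le[OF assms(3)] by (auto simp: defs)
  have "\<bar>a - b\<bar> \<le> d" "d \<le> a + b"
    using dist_triangle[of x y z] dist_triangle[of x z y] dist_triangle[of y z x]
    by (auto simp: defs dist_commute)
  then obtain y' z' :: "real ^ 2" where yz: "norm y' = a" "norm z' = b" "dist y' z' = d"
    using comparison_triangle[OF pos(1,2)] by metis
  obtain S where S: "geodesic_segment x y S" "p \<in> S"
    using metric_between_imp_on_segment[OF assms(1,2)] by blast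
  obtain T where T: "geodesic_segment x z T" "q \<in> T"
    using metric_between_imp_on_segment[OF assms(1,3)] by blast
  define p' q' where "p' = (s / a) *\<^sub>R y'" "q' = (t / b) *\<^sub>R z'"
  note p'_q'_def = this
  have seg: "p' \<in> closed_segment 0 y'" "q' \<in> closed_segment 0 z'"
    unfolding closed_segment_def p'_q'_def using pos
    by (auto intro: exI[of _ "s / a"] exI[of _ "t / b"])
  have n: "norm p' = s" "norm q' = t"
    using pos yz by (auto simp: p'_q'_def)
  have "dist p q \<le> dist p' q'"
    by (rule CAT0_comparison[OF assms(1) S(1) T(1) _ _ _ S(2) T(2) seg])
      (use yz n in \<open>simp_all add: defs\<close>)
  then have "(dist p q)\<^sup>2 \<le> (dist p' q')\<^sup>2" by (intro power_mono) auto
  also have "\<dots> = s\<^sup>2 + t\<^sup>2 - 2 * inner p' q'"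
    using dot_norm_neg[of p' q'] n by (simp add: dist_norm)
  finally have "a * b * (dist p q)\<^sup>2 \<le> a * b * (s\<^sup>2 + t\<^sup>2 - 2 * inner p' q')"
    using pos by (intro mult_left_mono) auto
  moreover have "a * b * inner p' q' = s * t * inner y' z'"
    using pos by (simp add: p'_q'_def)
  moreover have "2 * inner y' z' = a\<^sup>2 + b\<^sup>2 - d\<^sup>2"
    using yz by (simp add: dot_norm_neg dist_norm)
  then have "s * t * (2 * inner y' z') = s * t * (a\<^sup>2 + b\<^sup>2 - d\<^sup>2)" by simp
  ultimately have "a * b * ((dist p q)\<^sup>2 - (s - t)\<^sup>2) \<le> s * t * (d\<^sup>2 - (a - b)\<^sup>2)"
    by (simp add: algebra_simps power2_eq_square)
  then show ?thesis by (simp add: defs)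
qed

section \<open>Barycenters\<close>

text \<open>
  The CN inequality of Bruhat and Tits. With \<open>q\<close> as the endpoint of the second side, it is the CAT(0)
  inequality for the midpoint of the first side.
\<close>

lemma CAT0_midpoint:
  fixes x y :: "'a::metric_space"
  assumes "CAT0 TYPE('a)"
  obtains m where "\<And>q. (dist m q)\<^sup>2 \<le> (dist x q)\<^sup>2 / 2 + (dist y q)\<^sup>2 / 2 - (dist x y)\<^sup>2 / 4"
proof -
  obtain m where m: "metric_between x m y" "dist x m = dist x y / 2"
    using CAT0_point_at[OF assms, of "dist x y / 2" x y] by auto
  have "(dist m q)\<^sup>2 \<le> (dist x q)\<^sup>2 / 2 + (dist y q)\<^sup>2 / 2 - (dist x y)\<^sup>2 / 4" for q
  proof (cases "x = y \<or> x = q")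
    case True
    from True show ?thesis
    proof
      assume "x = y"
      then show ?thesis using m(2) by simp
    next
      assume "x = q"
      then have "(dist m q)\<^sup>2 = (dist x y / 2)\<^sup>2" using m(2) by (metis dist_commute)
      then show ?thesis using \<open>x = q\<close> by (simp add: dist_commute[of y] power_divide)
    qed
  next
    case False
    define a b where ab: "a = dist x y" "b = dist x q"
    have pos: "0 < a * b" using False by (simp add: ab)
    have "a * b * ((dist m q)\<^sup>2 - (a / 2 - b)\<^sup>2) \<le> a / 2 * b * ((dist y q)\<^sup>2 - (a - b)\<^sup>2)"
      using CAT0_inequality[OF assms m(1) metric_between_endpoint[of x q]] m(2) by (simp add: ab)
    then have "a * b * ((dist m q)\<^sup>2 - (a / 2 - b)\<^sup>2) \<le> a * b * (((dist y q)\<^sup>2 - (a - b)\<^sup>2) / 2)"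
      by simp
    then have "(dist m q)\<^sup>2 - (a / 2 - b)\<^sup>2 \<le> ((dist y q)\<^sup>2 - (a - b)\<^sup>2) / 2"
      using pos by (simp only: mult_le_cancel_left_pos)
    then show ?thesis by (simp add: ab[symmetric] power2_eq_square field_simps)
  qed
  then show ?thesis by (rule that)
qed

text \<open>
  The definition of \<open>barycenter\<close> has content only if the mean square distance has exactly one minimizer.
  The CN inequality makes this function uniformly convex (\<open>quad\<close> below), so that minimizing sequences
  are Cauchy and two minimizers coincide.
\<close>

lemma barycenter_minimizes:
  fixes \<mu> :: "'a::metric_space pmf"
  assumes "CAT0 TYPE('a)" "complete (UNIV :: 'a set)" "finite (set_pmf \<mu>)"
  shows "fs_integral \<mu> (\<lambda>q. (dist (barycenter \<mu>) q)\<^sup>2) \<le> fs_integral \<mu> (\<lambda>q. (dist x q)\<^sup>2)"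
proof -
  define F where "F x = fs_integral \<mu> (\<lambda>q. (dist x q)\<^sup>2)" for x :: 'a
  have total: "(\<Sum>q\<in>set_pmf \<mu>. pmf \<mu> q) = 1"
    using assms(3) by (simp add: sum_pmf_eq_1)
  have F0: "0 \<le> F x" for x
    unfolding F_def fs_integral_def by (intro sum_nonneg) auto
  have bdd: "bdd_below (range F)" using F0 by (intro bdd_belowI[of _ 0]) auto
  have mid: "\<exists>m. F m \<le> F x / 2 + F y / 2 - (dist x y)\<^sup>2 / 4" for x y
  proof -
    obtain m where m: "\<And>q. (dist m q)\<^sup>2 \<le> (dist x q)\<^sup>2 / 2 + (dist y q)\<^sup>2 / 2 - (dist x y)\<^sup>2 / 4"
      using CAT0_midpoint[OF assms(1)] by blast
    have "F m \<le> (\<Sum>q\<in>set_pmf \<mu>. pmf \<mu> q * ((dist x q)\<^sup>2 / 2 + (dist y q)\<^sup>2 / 2 - (dist x y)\<^sup>2 / 4))"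
      unfolding F_def fs_integral_def by (auto intro!: sum_mono mult_left_mono m)
    also have "\<dots> = (\<Sum>q\<in>set_pmf \<mu>. pmf \<mu> q * (dist x q)\<^sup>2 / 2 + pmf \<mu> q * (dist y q)\<^sup>2 / 2
        - pmf \<mu> q * ((dist x y)\<^sup>2 / 4))"
      by (intro sum.cong refl) (simp add: algebra_simps)
    also have "\<dots> = F x / 2 + F y / 2 - (\<Sum>q\<in>set_pmf \<mu>. pmf \<mu> q) * ((dist x y)\<^sup>2 / 4)"
      unfolding F_def fs_integral_def
      by (simp only: sum.distrib sum_subtractf sum_divide_distrib sum_distrib_right real_scaleR_def)
    finally show ?thesis using total by auto
  qed
  define I where "I = Inf (range F)"
  have I: "I \<le> F x" for x unfolding I_def using bdd by (intro cInf_lower) auto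
  \<comment> \<open>The midpoint of \<open>x\<close> and \<open>y\<close> cannot have a value below the infimum \<open>I\<close>.\<close>
  have quad: "(dist x y)\<^sup>2 \<le> 2 * (F x - I) + 2 * (F y - I)" for x y
  proof -
    obtain m where "F m \<le> F x / 2 + F y / 2 - (dist x y)\<^sup>2 / 4" using mid by blast
    then have "I \<le> F x / 2 + F y / 2 - (dist x y)\<^sup>2 / 4" using I order_trans by blast
    then show ?thesis by (simp add: field_simps)
  qed
  have "\<exists>x. F x < I + 1 / Suc n" for n
    using cInf_lessD[of "range F" "I + 1 / Suc n"] by (auto simp: I_def)
  then obtain X where X: "\<And>n. F (X n) < I + 1 / Suc n" by metis
  have "Cauchy X"
  proof (rule metric_CauchyI)
    fix e :: real assume "0 < e"
    then obtain M where M: "1 / Suc M < e\<^sup>2 / 4"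
      by (rule_tac nat_approx_posE[of "e\<^sup>2 / 4"]) auto
    have near: "F (X n) - I < e\<^sup>2 / 4" if "M \<le> n" for n
    proof -
      have "1 / real (Suc n) \<le> 1 / real (Suc M)" using that by (intro divide_left_mono) auto
      then show ?thesis using X[of n] M by linarith
    qed
    have "dist (X m) (X n) < e" if "M \<le> m" "M \<le> n" for m n
    proof -
      have "(dist (X m) (X n))\<^sup>2 < e\<^sup>2" using quad[of "X m" "X n"] near[OF that(1)] near[OF that(2)] by argo
      then show ?thesis using \<open>0 < e\<close> by (simp add: power2_less_imp_less)
    qed
    then show "\<exists>M. \<forall>m\<ge>M. \<forall>n\<ge>M. dist (X m) (X n) < e" by blast
  qed
  then obtain p where p: "X \<longlonglongrightarrow> p"
    using assms(2) by (auto simp: complete_def)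
  have "(\<lambda>n. F (X n)) \<longlonglongrightarrow> F p"
    unfolding F_def fs_integral_def by (intro tendsto_intros p)
  moreover have "(\<lambda>n. I + 1 / real (Suc n)) \<longlonglongrightarrow> I + 0"
    by (intro tendsto_intros LIMSEQ_inverse_real_of_nat[unfolded inverse_eq_divide])
  ultimately have "F p \<le> I + 0"
    using X by (intro LIMSEQ_le) (auto intro: less_imp_le)
  then have Fp: "F p = I" using I[of p] by simp
  have "barycenter \<mu> = p"
    unfolding barycenter_def F_def[symmetric]
  proof (rule the_equality)
    show "is_arg_min F (\<lambda>_. True) p" using I Fp by (simp add: is_arg_min_def not_less)
    fix r assume "is_arg_min F (\<lambda>_. True) r"
    then have "F r \<le> F p" by (simp add: is_arg_min_def not_less)
    then have "(dist r p)\<^sup>2 \<le> 0" using quad[of r p] Fp by argo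
    then show "r = p" by simp
  qed
  then show ?thesis using I Fp by (simp add: F_def[symmetric])
qed

section \<open>Prolonging geodesics\<close>

text \<open>
  Geodesic completeness prolongs local geodesics only to local geodesics. A short prolongation is good enough:
  near \<open>z\<close> the prolonged path is a geodesic, so the points \<open>A\<close> and \<open>B\<close> at distance \<open>h\<close> before and after
  \<open>z\<close> satisfy \<open>dist A B = 2 * h\<close>. The comparison angle at \<open>z\<close> is then \<open>\<pi>\<close>, and the CAT(0) inequality
  passes this on to the triangle with vertices \<open>x\<close>, \<open>z\<close>, \<open>B\<close>.
\<close>

lemma prolong_slightly:
  fixes x z :: "'a::metric_space"
  assumes "CAT0 TYPE('a)" "geodesically_complete TYPE('a)" "x \<noteq> z" "0 < \<epsilon>"
  obtains z' where "metric_between x z z'" "z' \<noteq> z" "dist z z' \<le> \<epsilon>"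
proof -
  define a where "a = dist x z"
  have a: "0 < a" using assms(3) by (simp add: a_def)
  obtain \<gamma> where g: "geodesic_on {0..a} \<gamma>" "\<gamma> 0 = x" "\<gamma> a = z"
    using CAT0_geodesic[OF assms(1)] unfolding a_def .
  have "local_geodesic_on {0..a} \<gamma>"
    unfolding local_geodesic_on_def using g(1) by (auto simp: geodesic_on_def intro!: exI[of _ 1])
  then obtain b \<gamma>' where b: "a < b" "local_geodesic_on {0..b} \<gamma>'" "\<And>t. t \<in> {0..a} \<Longrightarrow> \<gamma>' t = \<gamma> t"
    using assms(2) a unfolding geodesically_complete_def by blast
  then have "a \<in> {0..b}" using a by simp
  then obtain e where e: "e > 0" "geodesic_on ({0..b} \<inter> ball a e) \<gamma>'"
    using b(2) unfolding local_geodesic_on_def by blast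
  define h where "h = min (min (e / 2) a) (min (b - a) \<epsilon>)"
  have h: "0 < h" "h \<le> e / 2" "h \<le> a" "h \<le> b - a" "h \<le> \<epsilon>"
    using a b(1) e(1) assms(4) unfolding h_def by linarith+
  define A where "A = \<gamma>' (a - h)"
  define B where "B = \<gamma>' (a + h)"
  have dom: "a - h \<in> {0..b} \<inter> ball a e" "a \<in> {0..b} \<inter> ball a e" "a + h \<in> {0..b} \<inter> ball a e"
    using h a b(1) e(1) by (auto simp: dist_real_def)
  have z: "\<gamma>' a = z" using b(3)[of a] g(3) a by simp
  have dAB: "dist A B = 2 * h" "dist z B = h" "dist z A = h"
    using e(2) dom h(1) unfolding geodesic_on_def A_def B_def z[symmetric] by auto
  have "A = \<gamma> (a - h)" using b(3)[of "a - h"] h by (simp add: A_def)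
  then have "dist x A = a - h"
    using geodesic_metric_between(1)[OF g(1), of "a - h"] g(2) h by simp
  then have zAx: "metric_between z A x"
    using dAB by (simp add: metric_between_def dist_commute a_def)
  have "a * h * ((2 * h)\<^sup>2 - (h - h)\<^sup>2) \<le> h * h * ((dist x B)\<^sup>2 - (a - h)\<^sup>2)"
    using CAT0_inequality[OF assms(1) zAx metric_between_endpoint[of z B]]
    unfolding dAB by (simp add: dist_commute[of z x] a_def)
  then have "(h * h) * (4 * a * h) \<le> (h * h) * ((dist x B)\<^sup>2 - (a - h)\<^sup>2)"
    by (simp add: power2_eq_square algebra_simps)
  then have "4 * a * h \<le> (dist x B)\<^sup>2 - (a - h)\<^sup>2"
    using h(1) by simp
  then have "(a + h)\<^sup>2 \<le> (dist x B)\<^sup>2"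
    by (simp add: power2_eq_square algebra_simps)
  then have "a + h \<le> dist x B" by (rule power2_le_imp_le) simp
  then have "metric_between x z B"
    using dist_triangle[of x B z] dAB by (simp add: metric_between_def a_def)
  moreover have "B \<noteq> z" using dAB(2) h(1) by auto
  ultimately show ?thesis using that[of B] dAB(2) h(5) by simp
qed

text \<open>
  Compactness gives a prolongation that is longest among those of length at most \<open>r\<close>, and by
  \<open>prolong_slightly\<close> it cannot be shorter than \<open>r\<close>.
\<close>

lemma prolong_to_radius:
  fixes p q :: "'a::metric_space"
  assumes "CAT0 TYPE('a)" "geodesically_complete TYPE('a)" "compact (cball p r)"
    and "p \<noteq> q" "dist p q \<le> r"
  obtains z where "metric_between p q z" "dist p z = r"
proof -
  define Z where "Z = cball p r \<inter> {z. metric_between p q z}"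
  have "closed {z. metric_between p q z}"
    unfolding metric_between_def by (intro closed_Collect_eq continuous_intros)
  with assms(3) have "compact Z" unfolding Z_def by (rule compact_Int_closed)
  moreover have "q \<in> Z" using assms(5) by (simp add: Z_def)
  ultimately obtain z where z: "z \<in> Z" "\<And>y. y \<in> Z \<Longrightarrow> dist p y \<le> dist p z"
    using continuous_attains_sup[of Z "dist p"] continuous_on_dist[OF continuous_on_const continuous_on_id]
    by (metis empty_iff id_apply)
  then have zb: "metric_between p q z" "dist p z \<le> r" by (auto simp: Z_def)
  have "dist p z = r"
  proof (rule ccontr)
    assume "dist p z \<noteq> r"
    then have "0 < r - dist p z" using zb by simp
    moreover have "p \<noteq> z" using zb(1) assms(4) metric_between_le by fastforce
    ultimately obtain z' where z': "metric_between p z z'" "z' \<noteq> z" "dist z z' \<le> r - dist p z"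
      using prolong_slightly[OF assms(1,2)] by metis
    have "dist p z' = dist p z + dist z z'" using z'(1) by (simp add: metric_between_def)
    moreover have "z' \<in> Z"
      using metric_between_trans[OF zb(1) z'(1)] z'(3) calculation by (simp add: Z_def)
    ultimately show False using z(2)[of z'] z'(2) by simp
  qed
  with zb(1) show ?thesis by (rule that)
qed

text \<open>
  The directions at \<open>p\<close> towards points \<open>q\<close> at arbitrary distances are compared at two scales. Closeness of
  the points \<open>z\<close> on the sphere of radius \<open>r\<close> can be controlled by compactness, and the CAT(0) inequality
  carries it down to the points \<open>y\<close> at scale \<open>t\<close>. For \<open>q\<close> close to \<open>p\<close>, the point \<open>z\<close> lies beyond \<open>q\<close>.
\<close>

lemma common_initial_point:
  fixes p q :: "'a::metric_space"
  assumes "CAT0 TYPE('a)" "geodesically_complete TYPE('a)" "compact (cball p r)"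
    and "0 < t" "t \<le> r" "t \<le> dist p q"
  obtains y z where "dist p y = t" "metric_between p y q" "dist p z = r" "metric_between p y z"
proof (cases "dist p q \<le> r")
  case True
  have "p \<noteq> q" using assms by auto
  then obtain z where z: "metric_between p q z" "dist p z = r"
    using prolong_to_radius[OF assms(1-3) _ True] by blast
  obtain y where y: "metric_between p y q" "dist p y = t"
    using CAT0_point_at[OF assms(1)] assms(4,6) by (metis less_imp_le)
  show ?thesis using that[OF y(2,1) z(2) metric_between_trans[OF y(1) z(1)]] .
next
  case False
  then obtain z where z: "metric_between p z q" "dist p z = r"
    using CAT0_point_at[OF assms(1), of r p q] assms(4,5) by auto
  obtain y where y: "metric_between p y z" "dist p y = t"
    using CAT0_point_at[OF assms(1), of t p z] assms(4,5) z(2) by auto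
  show ?thesis using that[OF y(2) metric_between_trans[OF y(1) z(1)] z(2) y(1)] .
qed

section \<open>Uniform local compactness from a proper cocompact action\<close>

lemma isometric_action_inv:
  assumes "isometric_action G \<alpha>" "g \<in> carrier G"
  shows "\<alpha> (inv\<^bsub>G\<^esub> g) (\<alpha> g x) = x" "\<alpha> g (\<alpha> (inv\<^bsub>G\<^esub> g) x) = x" "inv\<^bsub>G\<^esub> g \<in> carrier G"
proof -
  interpret group_action G UNIV \<alpha> using assms(1) by (simp add: isometric_action_def)
  interpret group G using group_hom group_hom.axioms(1) by auto
  show c: "inv\<^bsub>G\<^esub> g \<in> carrier G" using assms(2) by simp
  show "\<alpha> (inv\<^bsub>G\<^esub> g) (\<alpha> g x) = x" using orbit_sym_aux[OF assms(2), of x] by simp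
  show "\<alpha> g (\<alpha> (inv\<^bsub>G\<^esub> g) x) = x" using orbit_sym_aux[OF c, of x] assms(2) by simp
qed

lemma isometric_action_cball:
  assumes "isometric_action G \<alpha>" "g \<in> carrier G"
  shows "\<alpha> g ` cball x r = cball (\<alpha> g x) r"
proof -
  have iso: "\<And>y z. dist (\<alpha> g y) (\<alpha> g z) = dist y z"
    using assms by (simp add: isometric_action_def)
  show ?thesis
  proof (intro equalityI subsetI)
    fix y assume y: "y \<in> cball (\<alpha> g x) r"
    have "y = \<alpha> g (\<alpha> (inv\<^bsub>G\<^esub> g) y)" using isometric_action_inv(2)[OF assms] by simp
    moreover from this have "\<alpha> (inv\<^bsub>G\<^esub> g) y \<in> cball x r" using y iso by (metis mem_cball)
    ultimately show "y \<in> \<alpha> g ` cball x r" by blast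
  qed (use iso in auto)
qed

lemma compact_finite_ball_cover:
  assumes "compact K" "\<And>k. 0 < \<rho> k"
  obtains I where "finite I" "K \<subseteq> (\<Union>k\<in>I. ball k (\<rho> k))"
proof -
  have "K \<subseteq> (\<Union>k\<in>K. ball k (\<rho> k))"
  proof
    fix x assume "x \<in> K"
    then show "x \<in> (\<Union>k\<in>K. ball k (\<rho> k))" by (rule UN_I) (simp add: assms(2))
  qed
  then obtain I where "I \<subseteq> K" "finite I" "K \<subseteq> (\<Union>k\<in>I. ball k (\<rho> k))"
    by (rule compactE_image[OF assms(1), where f = "\<lambda>k. ball k (\<rho> k)", rotated]) simp_all
  then show ?thesis using that by simp
qed

text \<open>
  The hypothesis on the action is a condition at each point \<open>k\<close>, at a scale \<open>\<rho> k\<close>. Finitely many balls of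
  radius \<open>\<rho> k / 2\<close> cover \<open>K\<close>, and \<open>r\<close> is taken small against their scales. If \<open>h\<close> and \<open>g\<close> move points
  of one such ball into \<open>ball p r\<close>, then \<open>inv h \<otimes> g\<close> moves a point of \<open>ball k (\<rho> k)\<close> to a point of
  the same ball, which leaves finitely many \<open>g\<close> for a fixed \<open>h\<close>.
\<close>

lemma proper_action_near_compact:
  assumes iso: "isometric_action G \<alpha>" and pro: "proper_action G \<alpha>" and "compact K"
  obtains r where "r > 0" "\<And>p. finite {g \<in> carrier G. \<alpha> g ` K \<inter> ball p r \<noteq> {}}"
proof -
  interpret group_action G UNIV \<alpha> using iso by (simp add: isometric_action_def)
  interpret group G using group_hom group_hom.axioms(1) by auto
  have dist: "\<And>g x y. g \<in> carrier G \<Longrightarrow> dist (\<alpha> g x) (\<alpha> g y) = dist x y"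
    using iso by (simp add: isometric_action_def)
  have "\<forall>k. \<exists>s. 0 < s \<and> finite {g \<in> carrier G. \<alpha> g ` ball k s \<inter> ball k s \<noteq> {}}"
    using pro by (simp add: proper_action_def)
  from choice[OF this] obtain \<rho> where
    \<rho>: "\<And>k. \<rho> k > 0" "\<And>k. finite {g \<in> carrier G. \<alpha> g ` ball k (\<rho> k) \<inter> ball k (\<rho> k) \<noteq> {}}"
    by auto
  obtain I where I: "finite I" "K \<subseteq> (\<Union>k\<in>I. ball k (\<rho> k / 2))"
    by (rule compact_finite_ball_cover[OF \<open>compact K\<close>, of "\<lambda>k. \<rho> k / 2"]) (use \<rho>(1) in simp)
  define r where "r = Min (insert 1 ((\<lambda>k. \<rho> k / 4) ` I))"
  have "0 < r" using I(1) \<rho>(1) by (simp add: r_def)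
  moreover have "r \<le> \<rho> k / 4" if "k \<in> I" for k
    unfolding r_def using I(1) that by (intro Min_le) auto
  ultimately have r: "0 < r" "\<And>k. k \<in> I \<Longrightarrow> r \<le> \<rho> k / 4" by auto
  have "finite {g \<in> carrier G. \<alpha> g ` K \<inter> ball p r \<noteq> {}}" for p
  proof -
    define S where "S k = {g \<in> carrier G. \<exists>u\<in>ball k (\<rho> k / 2). dist p (\<alpha> g u) < r}" for k
    have "finite (S k)" if "k \<in> I" for k
    proof (cases "S k = {}")
      case False
      then obtain h where "h \<in> S k" by blast
      then obtain v where h: "h \<in> carrier G" "dist k v < \<rho> k / 2" "dist p (\<alpha> h v) < r"
        unfolding S_def by auto
      have "inv\<^bsub>G\<^esub> h \<otimes>\<^bsub>G\<^esub> g \<in> {g \<in> carrier G. \<alpha> g ` ball k (\<rho> k) \<inter> ball k (\<rho> k) \<noteq> {}}"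
        if g: "g \<in> S k" for g
      proof -
        obtain u where u: "g \<in> carrier G" "dist k u < \<rho> k / 2" "dist p (\<alpha> g u) < r"
          using g unfolding S_def by auto
        let ?w = "\<alpha> (inv\<^bsub>G\<^esub> h \<otimes>\<^bsub>G\<^esub> g) u"
        have w: "\<alpha> h ?w = \<alpha> g u"
          using composition_rule[of u "inv\<^bsub>G\<^esub> h" g] u(1) h(1) isometric_action_inv[OF iso h(1)] by simp
        have "dist v ?w = dist (\<alpha> h v) (\<alpha> g u)" using dist[OF h(1), of v ?w] w by simp
        also have "\<dots> < 2 * r"
          using dist_triangle[of "\<alpha> h v" "\<alpha> g u" p] h(3) u(3) by (simp add: dist_commute)
        finally have "dist k ?w < \<rho> k"
          using dist_triangle[of k ?w v] h(2) r(2)[OF \<open>k \<in> I\<close>] by linarith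
        moreover have "u \<in> ball k (\<rho> k)" using u(2) \<rho>(1)[of k] by simp
        ultimately have "?w \<in> \<alpha> (inv\<^bsub>G\<^esub> h \<otimes>\<^bsub>G\<^esub> g) ` ball k (\<rho> k) \<inter> ball k (\<rho> k)" by simp
        moreover have "inv\<^bsub>G\<^esub> h \<otimes>\<^bsub>G\<^esub> g \<in> carrier G" using u(1) h(1) by simp
        ultimately show ?thesis by blast
      qed
      then have "(\<lambda>g. inv\<^bsub>G\<^esub> h \<otimes>\<^bsub>G\<^esub> g) ` S k \<subseteq> {g \<in> carrier G. \<alpha> g ` ball k (\<rho> k) \<inter> ball k (\<rho> k) \<noteq> {}}"
        by blast
      then have "finite ((\<lambda>g. inv\<^bsub>G\<^esub> h \<otimes>\<^bsub>G\<^esub> g) ` S k)"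
        using \<rho>(2) by (rule finite_subset)
      moreover have "inj_on (\<lambda>g. inv\<^bsub>G\<^esub> h \<otimes>\<^bsub>G\<^esub> g) (S k)"
        using h(1) by (auto simp: inj_on_def S_def)
      ultimately show ?thesis by (rule finite_imageD)
    qed simp
    moreover have "{g \<in> carrier G. \<alpha> g ` K \<inter> ball p r \<noteq> {}} \<subseteq> (\<Union>k\<in>I. S k)"
    proof
      fix g assume "g \<in> {g \<in> carrier G. \<alpha> g ` K \<inter> ball p r \<noteq> {}}"
      then obtain u where u: "g \<in> carrier G" "u \<in> K" "dist p (\<alpha> g u) < r" by auto
      moreover obtain k where "k \<in> I" "u \<in> ball k (\<rho> k / 2)" using I(2) u(2) by blast
      ultimately show "g \<in> (\<Union>k\<in>I. S k)" unfolding S_def by blast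
    qed
    ultimately show ?thesis using I(1) finite_subset[OF _ finite_UN_I[of I S]] by simp
  qed
  with r(1) show ?thesis by (rule that)
qed

text \<open>
  A ball of small radius meets only finitely many translates of the compact set \<open>K\<close>, which cover the
  space; so it lies in a compact set. A cover of a neighborhood of \<open>K\<close> then serves every center after
  translation by the group.
\<close>

lemma uniform_covers:
  fixes \<alpha> :: "'g \<Rightarrow> 'a::metric_space \<Rightarrow> 'a"
  assumes iso: "isometric_action G \<alpha>" and pro: "proper_action G \<alpha>" and coc: "cocompact_action G \<alpha>"
  obtains r N where "r > 0" "\<And>x::'a. compact (cball x r)"
    "\<And>x::'a. \<exists>F. finite F \<and> card F \<le> N \<and> cball x r \<subseteq> (\<Union>f\<in>F. ball f (r / 8))"
proof -
  obtain K where K: "compact K" "UNIV = (\<Union>g\<in>carrier G. \<alpha> g ` K)"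
    using coc by (auto simp: cocompact_action_def)
  have dist: "\<And>g x y. g \<in> carrier G \<Longrightarrow> dist (\<alpha> g x) (\<alpha> g y) = dist x y"
    using iso by (simp add: isometric_action_def)
  have cont: "continuous_on A (\<alpha> g)" if "g \<in> carrier G" for g A
    unfolding continuous_on_iff using dist[OF that] by auto
  obtain R where R: "R > 0" "\<And>p. finite {g \<in> carrier G. \<alpha> g ` K \<inter> ball p R \<noteq> {}}"
    using proper_action_near_compact[OF iso pro K(1)] by blast
  have comp: "compact (cball p s)" if "s < R" for p :: 'a and s
  proof -
    let ?H = "{g \<in> carrier G. \<alpha> g ` K \<inter> ball p R \<noteq> {}}"
    have UN: "compact (\<Union>g\<in>?H. \<alpha> g ` K)"
      using R(2) K(1) cont by (intro compact_UN compact_continuous_image) auto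
    have "cball p s \<subseteq> (\<Union>g\<in>?H. \<alpha> g ` K)"
    proof
      fix y assume "y \<in> cball p s"
      then have "y \<in> ball p R" using that by simp
      moreover obtain g where "g \<in> carrier G" "y \<in> \<alpha> g ` K" using K(2) by blast
      ultimately have "g \<in> ?H" by (simp add: disjoint_iff) blast
      then show "y \<in> (\<Union>g\<in>?H. \<alpha> g ` K)" using \<open>y \<in> \<alpha> g ` K\<close> by (rule UN_I)
    qed
    then have "(\<Union>g\<in>?H. \<alpha> g ` K) \<inter> cball p s = cball p s" by (rule Int_absorb1)
    then show ?thesis
      using compact_Int_closed[OF UN closed_cball[of p s]] by simp
  qed
  define r where "r = R / 4"
  have r: "0 < r" using R(1) by (simp add: r_def)
  obtain I where I: "finite I" "K \<subseteq> (\<Union>k\<in>I. ball k r)"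
    by (rule compact_finite_ball_cover[OF K(1), of "\<lambda>_. r"]) (use r in simp)
  have "compact (\<Union>k\<in>I. cball k (2 * r))"
    using I(1) R(1) by (intro compact_UN comp) (auto simp: r_def)
  then obtain F where F: "finite F" "(\<Union>k\<in>I. cball k (2 * r)) \<subseteq> (\<Union>f\<in>F. ball f (r / 8))"
    by (rule compact_finite_ball_cover[of _ "\<lambda>_. r / 8"]) (use r in simp)
  show ?thesis
  proof (rule that[OF r, of "card F"])
    show "compact (cball x r)" for x :: 'a using R(1) by (intro comp) (simp add: r_def)
    fix x :: 'a
    obtain g k where g: "g \<in> carrier G" "k \<in> K" "x = \<alpha> g k" using K(2) by blast
    obtain i where i: "i \<in> I" "dist i k < r" using I(2) g(2) by auto
    have "cball k r \<subseteq> cball i (2 * r)"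
    proof
      fix y assume "y \<in> cball k r"
      then show "y \<in> cball i (2 * r)" using dist_triangle[of i y k] i(2) by simp
    qed
    then have "cball k r \<subseteq> (\<Union>f\<in>F. ball f (r / 8))" using F(2) i(1) by blast
    then have "\<alpha> g ` cball k r \<subseteq> (\<Union>f\<in>\<alpha> g ` F. ball f (r / 8))"
      using dist[OF g(1)] by fastforce
    then have "cball x r \<subseteq> (\<Union>f\<in>\<alpha> g ` F. ball f (r / 8))"
      using isometric_action_cball[OF iso g(1)] g(3) by simp
    then show "\<exists>F'. finite F' \<and> card F' \<le> card F \<and> cball x r \<subseteq> (\<Union>f\<in>F'. ball f (r / 8))"
      using F(1) card_image_le[OF F(1)] by (intro exI[of _ "\<alpha> g ` F"]) auto
  qed
qed

section \<open>Averages of unit vectors in the plane\<close>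

lemma one_minus_cos_le: "1 - cos x \<le> x\<^sup>2 / 2" for x :: real
proof -
  obtain t where "cos x = (\<Sum>m<2. cos_coeff m * x ^ m) + cos (t + 1/2 * real 2 * pi) / fact 2 * x ^ 2"
    using Maclaurin_cos_expansion[of x 2] by blast
  then have "cos x = 1 - cos t * (x\<^sup>2 / 2)"
    by (simp add: numeral_2_eq_2 cos_coeff_def)
  moreover have "cos t * (x\<^sup>2 / 2) \<le> 1 * (x\<^sup>2 / 2)" by (intro mult_right_mono) auto
  ultimately show ?thesis by simp
qed

text \<open>
  The bound \<open>2\<close> is the largest chord of a unit circle; there the fourth-order Taylor term is at most a third
  of the quadratic one.
\<close>

lemma one_minus_cos_ge:
  fixes x :: real
  assumes "\<bar>x\<bar> \<le> 2"
  shows "x\<^sup>2 / 3 \<le> 1 - cos x"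
proof -
  obtain t where "cos x = (\<Sum>m<4. cos_coeff m * x ^ m) + cos (t + 1/2 * real 4 * pi) / fact 4 * x ^ 4"
    using Maclaurin_cos_expansion[of x 4] by blast
  moreover have "cos (t + 1/2 * real 4 * pi) = cos t"
    using cos_periodic[of t] by (simp add: mult.commute[of pi])
  moreover have "(\<Sum>m<4. cos_coeff m * x ^ m) = 1 - x\<^sup>2 / 2"
    by (simp add: cos_coeff_def lessThan_nat_numeral fact_numeral)
  moreover have "fact 4 = (24 :: real)" by (simp add: fact_numeral)
  ultimately have "cos x = 1 - x\<^sup>2 / 2 + cos t * (x ^ 4 / 24)" by simp
  moreover have "cos t * (x ^ 4 / 24) \<le> 1 * (x ^ 4 / 24)" by (intro mult_right_mono) auto
  moreover have "x ^ 4 \<le> 4 * x\<^sup>2"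
  proof -
    have "x\<^sup>2 \<le> 4" using assms abs_le_square_iff[of x 2] by simp
    then have "x\<^sup>2 * x\<^sup>2 \<le> 4 * x\<^sup>2" by (intro mult_right_mono) auto
    then show ?thesis by (simp add: power2_eq_square eval_nat_numeral mult.assoc)
  qed
  ultimately show ?thesis by argo
qed

lemma inner_cis: "inner (cis a) (cis b) = cos (a - b)"
  by (simp add: inner_complex_def cos_diff)

text \<open>
  The defect \<open>(sum w S)\<^sup>2 - (norm (\<Sum> w q *\<^sub>R cis (\<theta> q)))\<^sup>2\<close> is the double sum of
  \<open>w q * w s * (1 - cos (\<theta> q - \<theta> s))\<close>, which is comparable to the variance of \<open>\<theta>\<close>. The pairs
  with \<open>q\<close> in \<open>A\<close> suffice to bound it from below: there \<open>\<theta> q \<le> 1/4\<close>, while the mean of \<open>\<theta>\<close> is at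
  least \<open>3/4\<close>.
\<close>

lemma cis_average_le:
  fixes w \<theta> :: "'a \<Rightarrow> real" and N :: real
  assumes "finite S" and w: "\<And>q. q \<in> S \<Longrightarrow> 0 \<le> w q" and \<theta>: "\<And>q. q \<in> S \<Longrightarrow> 0 \<le> \<theta> q \<and> \<theta> q \<le> 2"
    and "A \<subseteq> S" and A: "\<And>q. q \<in> A \<Longrightarrow> \<theta> q \<le> 1/4" and heavy: "sum w S \<le> N * sum w A"
    and mean: "3/4 * sum w S \<le> (\<Sum>q\<in>S. w q * \<theta> q)" and "0 < N"
  shows "(norm (\<Sum>q\<in>S. w q *\<^sub>R cis (\<theta> q)))\<^sup>2 \<le> (1 - 1 / (12 * N)) * (sum w S)\<^sup>2"
proof -
  define D where "D = sum w S"
  have D0: "0 \<le> D" unfolding D_def by (intro sum_nonneg w)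
  have "(D / N) * (D / 12) \<le> sum w A * (D / 12)"
    using heavy D0 assms(8) by (intro mult_right_mono) (auto simp: D_def field_simps)
  also have "\<dots> = (\<Sum>q\<in>A. w q * (D / 12))"
    by (rule sum_distrib_right)
  also have "\<dots> \<le> (\<Sum>q\<in>A. \<Sum>s\<in>S. w q * w s * ((\<theta> q - \<theta> s)\<^sup>2 / 3))"
  proof (rule sum_mono)
    fix q assume q: "q \<in> A"
    then have wq: "0 \<le> w q" using w assms(4) by auto
    \<comment> \<open>Integrate \<open>x\<^sup>2 \<ge> x - 1/4\<close> for \<open>x = \<theta> s - \<theta> q\<close>, a tangent line of the square that is
      at least \<open>1/4\<close> on average.\<close>
    have "D / 12 \<le> ((\<Sum>s\<in>S. w s * \<theta> s) - 1/2 * D) / 3"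
      using mean by (simp add: D_def)
    also have "\<dots> = (\<Sum>s\<in>S. w s * ((\<theta> s - 1/2) / 3))"
      by (simp add: D_def sum_distrib_left sum_divide_distrib sum_subtractf[symmetric] algebra_simps
          diff_divide_distrib)
    also have "\<dots> \<le> (\<Sum>s\<in>S. w s * ((\<theta> q - \<theta> s)\<^sup>2 / 3))"
    proof (intro sum_mono mult_left_mono w)
      fix s assume "s \<in> S"
      have "0 \<le> (\<theta> s - \<theta> q - 1/2)\<^sup>2" by simp
      then have "\<theta> s - \<theta> q - 1/4 \<le> (\<theta> q - \<theta> s)\<^sup>2"
        by (simp add: power2_eq_square algebra_simps)
      then show "(\<theta> s - 1/2) / 3 \<le> (\<theta> q - \<theta> s)\<^sup>2 / 3"
        using A[OF q] by argo
    qed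
    finally have "w q * (D / 12) \<le> w q * (\<Sum>s\<in>S. w s * ((\<theta> q - \<theta> s)\<^sup>2 / 3))"
      using wq by (rule mult_left_mono)
    then show "w q * (D / 12) \<le> (\<Sum>s\<in>S. w q * w s * ((\<theta> q - \<theta> s)\<^sup>2 / 3))"
      by (simp add: sum_distrib_left mult.assoc)
  qed
  also have "\<dots> \<le> (\<Sum>q\<in>S. \<Sum>s\<in>S. w q * w s * ((\<theta> q - \<theta> s)\<^sup>2 / 3))"
    using assms(1,4) w by (intro sum_mono2 sum_nonneg mult_nonneg_nonneg) auto
  also have "\<dots> \<le> (\<Sum>q\<in>S. \<Sum>s\<in>S. w q * w s * (1 - cos (\<theta> q - \<theta> s)))"
  proof (intro sum_mono mult_left_mono one_minus_cos_ge)
    fix q s assume "q \<in> S" "s \<in> S"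
    then show "\<bar>\<theta> q - \<theta> s\<bar> \<le> 2" using \<theta>[of q] \<theta>[of s] by (auto simp: abs_le_iff)
  qed (use w in simp)
  also have "\<dots> = (\<Sum>q\<in>S. \<Sum>s\<in>S. w q * w s) - (\<Sum>q\<in>S. \<Sum>s\<in>S. w q * w s * cos (\<theta> q - \<theta> s))"
    by (simp only: sum_subtractf[symmetric] right_diff_distrib mult_1_right)
  also have "(\<Sum>q\<in>S. \<Sum>s\<in>S. w q * w s) = D\<^sup>2"
    unfolding D_def power2_eq_square by (simp add: sum_product)
  also have "(\<Sum>q\<in>S. \<Sum>s\<in>S. w q * w s * cos (\<theta> q - \<theta> s))
      = (norm (\<Sum>q\<in>S. w q *\<^sub>R cis (\<theta> q)))\<^sup>2"
    unfolding power2_norm_eq_inner inner_sum_left inner_sum_right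
    by (subst sum.swap) (simp add: inner_cis mult_ac)
  finally show ?thesis
    by (simp add: D_def[symmetric] algebra_simps power2_eq_square)
qed

lemma heavy_class:
  fixes w :: "'a \<Rightarrow> real"
  assumes "finite T" "finite F" "k ` T \<subseteq> F" "0 < sum w T" and w: "\<And>q. q \<in> T \<Longrightarrow> 0 \<le> w q"
  obtains f where "f \<in> F" "sum w T \<le> card F * sum w {q \<in> T. k q = f}"
proof (rule ccontr)
  assume no: "\<not> thesis"
  have less: "card F * sum w {q \<in> T. k q = f} < sum w T" if f: "f \<in> F" for f
  proof (rule ccontr)
    assume "\<not> ?thesis"
    then have thesis using f by (intro \<open>\<And>f. f \<in> F \<Longrightarrow> sum w T \<le> card F * sum w {q \<in> T. k q = f} \<Longrightarrow> thesis\<close>) (simp_all add: not_less)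
    with no show False ..
  qed
  have "F \<noteq> {}" using assms(3,4) by auto
  have "card F * sum w T = (\<Sum>f\<in>F. card F * sum w {q \<in> T. k q = f})"
    unfolding sum_distrib_left[symmetric] using sum.group[OF assms(1,2,3), of w] by simp
  also have "\<dots> < (\<Sum>f\<in>F. sum w T)"
    using assms(2) \<open>F \<noteq> {}\<close> less by (rule sum_strict_mono)
  finally show False by simp
qed

section \<open>The estimate for a single measure\<close>

text \<open>
  The points \<open>q\<close> and \<open>q'\<close> are sent to polar coordinates around \<open>p\<close>. The squared distance of the images is
  \<open>(a - b)\<^sup>2 + 2 * a * b * (1 - cos (\<theta> - \<theta>'))\<close>, and the CAT(0) inequality bounds
  \<open>(dist q q')\<^sup>2\<close> from below by \<open>(a - b)\<^sup>2 + a * b * (dist y y' / t)\<^sup>2\<close>.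
\<close>

lemma cone_map_nonexpanding:
  fixes p q q' y y' :: "'a::metric_space"
  assumes "CAT0 TYPE('a)" "metric_between p y q" "metric_between p y' q'"
    and "dist p y = t" "dist p y' = t" "0 < t" "\<bar>\<theta> - \<theta>'\<bar> \<le> dist y y' / t"
  shows "norm (dist p q *\<^sub>R cis \<theta> - dist p q' *\<^sub>R cis \<theta>') \<le> dist q q'"
proof -
  define a b where "a = dist p q" "b = dist p q'"
  note ab = this
  have "(norm (a *\<^sub>R cis \<theta> - b *\<^sub>R cis \<theta>'))\<^sup>2 = (a - b)\<^sup>2 + 2 * (a * b) * (1 - cos (\<theta> - \<theta>'))"
    unfolding power2_norm_eq_inner inner_cis[symmetric]
    by (simp add: inner_diff_left inner_diff_right inner_commute[of "cis \<theta>'" "cis \<theta>"]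
        power2_eq_square algebra_simps) (simp add: inner_cis)
  also have "\<dots> \<le> (a - b)\<^sup>2 + 2 * (a * b) * ((\<theta> - \<theta>')\<^sup>2 / 2)"
    by (intro add_left_mono mult_left_mono one_minus_cos_le) (simp add: ab)
  also have "\<dots> \<le> (a - b)\<^sup>2 + 2 * (a * b) * ((dist y y' / t)\<^sup>2 / 2)"
  proof -
    have "(\<theta> - \<theta>')\<^sup>2 \<le> (dist y y' / t)\<^sup>2"
      using power_mono[OF assms(7), of 2] by simp
    then show ?thesis by (intro add_left_mono mult_left_mono) (simp_all add: ab)
  qed
  also have "\<dots> = (a - b)\<^sup>2 + a * b * (dist y y')\<^sup>2 / t\<^sup>2"
    by (simp add: power_divide)
  also have "a * b * (dist y y')\<^sup>2 \<le> t\<^sup>2 * ((dist q q')\<^sup>2 - (a - b)\<^sup>2)"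
    using CAT0_inequality[OF assms(1-3)] by (simp add: assms(4,5) ab power2_eq_square)
  then have "(a - b)\<^sup>2 + a * b * (dist y y')\<^sup>2 / t\<^sup>2 \<le> (dist q q')\<^sup>2"
    using assms(6) by (simp add: field_simps)
  finally show ?thesis unfolding ab by (rule power2_le_imp_le) simp
qed

text \<open>
  The angles are measured from the point \<open>u\<close> of a heavy class of directions. The class is small enough
  to have \<open>\<theta> \<le> 1/4\<close>, and the minimizing property of the barycenter forces the mean of \<open>\<theta>\<close> to be at
  least \<open>3/4\<close>, so \<open>cis_average_le\<close> applies to the resulting map into the plane.
\<close>

lemma IN_delta_measure_le:
  fixes \<mu> :: "'a::metric_space pmf" and N :: nat
  assumes CAT0: "CAT0 TYPE('a)" and gc: "geodesically_complete TYPE('a)"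
    and \<mu>: "\<mu> \<in> fs_measures" and r: "0 < r" "compact (cball (barycenter \<mu>) r)"
    and cover: "finite F" "card F \<le> N" "cball (barycenter \<mu>) r \<subseteq> (\<Union>f\<in>F. ball f (r / 8))"
  shows "IN_delta_measure \<mu> \<le> 1 - 1 / (12 * real N)"
proof -
  define p where "p = barycenter \<mu>"
  define S where "S = set_pmf \<mu>"
  define T where "T = S - {p}"
  define w where "w q = pmf \<mu> q * dist p q" for q
  define D where "D = sum w S"
  have fin: "finite S" and card: "2 \<le> card S" using \<mu> by (auto simp: fs_measures_def S_def)
  have total: "(\<Sum>q\<in>S. pmf \<mu> q) = 1" using fin by (simp add: sum_pmf_eq_1 S_def)
  have finT: "finite T" using fin by (simp add: T_def)
  have w0: "0 \<le> w q" for q by (simp add: w_def)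
  have DT: "sum w T = D"
    unfolding D_def T_def using fin by (intro sum.mono_neutral_left) (auto simp: w_def)
  have "T \<noteq> {}"
  proof
    assume "T = {}"
    then have "card S \<le> card {p}" by (intro card_mono) (auto simp: T_def)
    then show False using card by simp
  qed
  moreover have "0 < w q" if "q \<in> T" for q
    using that by (auto simp: T_def S_def w_def intro!: mult_pos_pos pmf_positive)
  ultimately have D: "0 < D" unfolding DT[symmetric] using finT by (intro sum_pos) auto
  \<comment> \<open>The bound \<open>t \<le> D / 2\<close> makes the second-order term in the estimate of the mean of \<open>\<theta>\<close>
    cost at most \<open>D / 4\<close>.\<close>
  define t where "t = Min (insert r (insert (D / 2) (dist p ` T)))"
  have tT: "t \<le> dist p q" if "q \<in> T" for q
    unfolding t_def using finT that by (intro Min_le) auto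
  have tr: "t \<le> r" and tD: "t \<le> D / 2"
    unfolding t_def using finT by (rule_tac Min_le, simp, simp)+
  have t: "0 < t" unfolding t_def using finT r(1) D by (auto simp: T_def)
  have "\<forall>q\<in>T. \<exists>yz. dist p (fst yz) = t \<and> metric_between p (fst yz) q
      \<and> dist p (snd yz) = r \<and> metric_between p (fst yz) (snd yz)"
  proof
    fix q assume "q \<in> T"
    obtain y z where "dist p y = t" "metric_between p y q" "dist p z = r" "metric_between p y z"
      by (rule common_initial_point[OF CAT0 gc r(2) t tr tT[OF \<open>q \<in> T\<close>, unfolded p_def], folded p_def])
    then show "\<exists>yz. dist p (fst yz) = t \<and> metric_between p (fst yz) q
      \<and> dist p (snd yz) = r \<and> metric_between p (fst yz) (snd yz)"
      by (intro exI[of _ "(y, z)"]) simp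
  qed
  from bchoice[OF this] obtain yz where yz: "\<forall>q\<in>T. dist p (fst (yz q)) = t \<and> metric_between p (fst (yz q)) q
      \<and> dist p (snd (yz q)) = r \<and> metric_between p (fst (yz q)) (snd (yz q))" ..
  define y where "y q = fst (yz q)" for q
  define z where "z q = snd (yz q)" for q
  have y: "dist p (y q) = t" "metric_between p (y q) q" and z: "dist p (z q) = r" "metric_between p (y q) (z q)"
    if "q \<in> T" for q using yz that by (auto simp: y_def z_def)
  have "\<forall>q\<in>T. \<exists>f\<in>F. dist f (z q) < r / 8"
  proof
    fix q assume "q \<in> T"
    then have "z q \<in> cball (barycenter \<mu>) r" using z(1) by (simp add: p_def)
    then have "z q \<in> (\<Union>f\<in>F. ball f (r / 8))" using cover(3) by blast
    then show "\<exists>f\<in>F. dist f (z q) < r / 8" unfolding UN_iff mem_ball .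
  qed
  from bchoice[OF this[unfolded Bex_def]] obtain k where
    k: "\<forall>q\<in>T. k q \<in> F \<and> dist (k q) (z q) < r / 8" ..
  then have kF: "k ` T \<subseteq> F" by auto
  have "0 < sum w T" unfolding DT by (rule D)
  from heavy_class[OF finT cover(1) kF this w0]
  obtain f where f: "sum w T \<le> card F * sum w {q \<in> T. k q = f}" .
  define A where "A = {q \<in> T. k q = f}"
  have "card F * sum w A \<le> N * sum w A"
    using cover(2) by (intro mult_right_mono sum_nonneg w0) simp
  moreover have "D \<le> card F * sum w A" using f unfolding DT A_def .
  ultimately have heavy: "D \<le> N * sum w A" by (rule order_trans[rotated])
  then have pos: "0 < N * sum w A" using D by linarith
  then have N: "0 < real N" by (cases "N = 0") auto
  from pos have "A \<noteq> {}" by auto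
  then obtain u where u: "u \<in> A" by blast
  then have uT: "u \<in> T" by (simp add: A_def)
  \<comment> \<open>The barycenter itself may belong to the support. It has no direction, but its weight
    and its image vanish, so that any angle in the range \<open>[0, 2]\<close> will do.\<close>
  define \<theta> where "\<theta> q = (if q = p then 0 else dist (y u) (y q) / t)" for q
  have \<theta>T: "\<theta> q = dist (y u) (y q) / t" if "q \<in> T" for q
    using that by (simp add: \<theta>_def T_def)
  have ST: "q \<in> T \<or> q = p" if "q \<in> S" for q using that by (auto simp: T_def)
  have \<theta>_bounds: "0 \<le> \<theta> q \<and> \<theta> q \<le> 2" if "q \<in> S" for q
    using ST[OF that]
  proof
    assume q: "q \<in> T"
    have "dist (y u) (y q) \<le> 2 * t"
      using dist_triangle[of "y u" "y q" p] y(1)[OF q] y(1)[OF uT] by (simp add: dist_commute)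
    then show ?thesis unfolding \<theta>T[OF q] using t by (simp add: field_simps)
  qed (simp add: \<theta>_def)
  have \<theta>_small: "\<theta> q \<le> 1/4" if "q \<in> A" for q
  proof -
    have q: "q \<in> T" "k q = k u" using that u by (auto simp: A_def)
    have "dist (k u) (z q) < r / 8" "dist (k u) (z u) < r / 8"
      using k q uT by metis+
    then have "dist (z u) (z q) \<le> r / 4"
      using dist_triangle[of "z u" "z q" "k u"] by (simp add: dist_commute)
    then have "(dist (z u) (z q))\<^sup>2 \<le> (r / 4)\<^sup>2" by (intro power_mono) auto
    then have "t * t * (dist (z u) (z q))\<^sup>2 \<le> t * t * (r / 4)\<^sup>2" by (intro mult_left_mono) auto
    moreover have "r * r * (dist (y u) (y q))\<^sup>2 \<le> t * t * (dist (z u) (z q))\<^sup>2"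
      using CAT0_inequality[OF CAT0 z(2)[OF uT] z(2)[OF q(1)]]
      by (simp add: y(1)[OF uT] y(1)[OF q(1)] z(1)[OF uT] z(1)[OF q(1)])
    ultimately have "(r * dist (y u) (y q))\<^sup>2 \<le> (t * (r / 4))\<^sup>2"
      by (simp add: power2_eq_square algebra_simps)
    then have "r * dist (y u) (y q) \<le> t * (r / 4)"
      by (rule power2_le_imp_le) (use t r(1) in simp)
    then have "r * dist (y u) (y q) \<le> r * (t / 4)" by (simp add: mult.commute)
    then have "dist (y u) (y q) \<le> t / 4" using r(1) by (simp only: mult_le_cancel_left_pos)
    then show ?thesis unfolding \<theta>T[OF q(1)] using t by (simp add: field_simps)
  qed
  \<comment> \<open>Compare \<open>p\<close> with \<open>y u\<close>: going from \<open>y u\<close> to \<open>q\<close> through \<open>y q\<close> shows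
    \<open>dist (y u) q \<le> dist p q + t * (\<theta> q - 1)\<close>.\<close>
  have mean: "3/4 * D \<le> (\<Sum>q\<in>S. w q * \<theta> q)"
  proof -
    have "complete (UNIV :: 'a set)" using gc by (simp add: geodesically_complete_def)
    from barycenter_minimizes[OF CAT0 this, of \<mu> "y u"]
    have "(\<Sum>q\<in>S. pmf \<mu> q * (dist p q)\<^sup>2) \<le> (\<Sum>q\<in>S. pmf \<mu> q * (dist (y u) q)\<^sup>2)"
      using fin by (simp add: fs_integral_def p_def S_def)
    also have "\<dots> \<le> (\<Sum>q\<in>S. pmf \<mu> q * ((dist p q)\<^sup>2 + 2 * t * (dist p q * (\<theta> q - 1)) + t\<^sup>2))"
    proof (intro sum_mono mult_left_mono)
      fix q assume "q \<in> S"
      from ST[OF this] show "(dist (y u) q)\<^sup>2 \<le> (dist p q)\<^sup>2 + 2 * t * (dist p q * (\<theta> q - 1)) + t\<^sup>2"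
      proof
        assume "q = p"
        then show ?thesis using y(1)[OF uT] by (simp add: dist_commute)
      next
        assume q: "q \<in> T"
        have "dist (y u) q \<le> dist p q + t * (\<theta> q - 1)"
          using dist_triangle[of "y u" q "y q"] y[OF q] t
          by (simp add: \<theta>T[OF q] metric_between_def algebra_simps)
        then have "(dist (y u) q)\<^sup>2 \<le> (dist p q + t * (\<theta> q - 1))\<^sup>2" by (intro power_mono) auto
        also have "\<dots> = (dist p q)\<^sup>2 + 2 * t * (dist p q * (\<theta> q - 1)) + t\<^sup>2 * (\<theta> q - 1)\<^sup>2"
          by (simp add: power2_eq_square algebra_simps)
        also have "t\<^sup>2 * (\<theta> q - 1)\<^sup>2 \<le> t\<^sup>2 * 1"
          using \<theta>_bounds[OF \<open>q \<in> S\<close>] by (intro mult_left_mono) (auto simp: abs_square_le_1 abs_le_iff)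
        finally show ?thesis by simp
      qed
    qed simp
    also have "\<dots> = (\<Sum>q\<in>S. pmf \<mu> q * (dist p q)\<^sup>2 + 2 * t * (w q * \<theta> q) - 2 * t * w q + pmf \<mu> q * t\<^sup>2)"
      by (intro sum.cong refl) (simp add: w_def algebra_simps)
    also have "\<dots> = (\<Sum>q\<in>S. pmf \<mu> q * (dist p q)\<^sup>2) + 2 * t * (\<Sum>q\<in>S. w q * \<theta> q) - 2 * t * D + t\<^sup>2"
      using total by (simp add: sum.distrib sum_subtractf sum_distrib_left[symmetric]
          sum_distrib_right[symmetric] D_def)
    finally have "0 \<le> t * (2 * (\<Sum>q\<in>S. w q * \<theta> q) - 2 * D + t)"
      by (simp add: power2_eq_square algebra_simps)
    then have "0 \<le> 2 * (\<Sum>q\<in>S. w q * \<theta> q) - 2 * D + t"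
      using t by (simp add: zero_le_mult_iff)
    then show ?thesis using tD by simp
  qed
  define \<phi> where "\<phi> q = dist p q *\<^sub>R cis (\<theta> q)" for q
  have "IN_admissible \<mu> \<phi>"
    unfolding IN_admissible_def p_def[symmetric] S_def[symmetric]
  proof (intro conjI ballI)
    show "norm (\<phi> q) = dist q p" for q by (simp add: \<phi>_def dist_commute)
    fix q q' assume "q \<in> S" "q' \<in> S"
    then consider "q \<in> T" "q' \<in> T" | "q = p" | "q' = p" using ST by blast
    then show "norm (\<phi> q - \<phi> q') \<le> dist q q'"
    proof cases
      case 1
      have "\<bar>dist (y u) (y q) - dist (y u) (y q')\<bar> \<le> dist (y q) (y q')"
        using dist_triangle[of "y u" "y q" "y q'"] dist_triangle[of "y u" "y q'" "y q"]
        by (simp add: dist_commute abs_le_iff)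
      then have "\<bar>\<theta> q - \<theta> q'\<bar> \<le> dist (y q) (y q') / t"
        using t by (simp add: \<theta>T 1 diff_divide_distrib[symmetric] divide_right_mono)
      then show ?thesis unfolding \<phi>_def
        using 1 t y by (intro cone_map_nonexpanding[OF CAT0, of p "y q" q "y q'" q' t]) auto
    qed (simp_all add: \<phi>_def dist_commute)
  qed
  then obtain \<psi> :: "'a \<Rightarrow> ell2" where \<psi>: "IN_admissible \<mu> \<psi>" "IN_ratio \<mu> \<psi> = IN_ratio \<mu> \<phi>"
    using IN_ratio_ell2 fin unfolding S_def by blast
  define Q where "Q = (\<Sum>q\<in>S. pmf \<mu> q * (dist p q)\<^sup>2)"
  \<comment> \<open>The variance of the distance to \<open>p\<close> is nonnegative.\<close>
  have DQ: "D\<^sup>2 \<le> Q"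
  proof -
    have "0 \<le> (\<Sum>q\<in>S. pmf \<mu> q * (dist p q - D)\<^sup>2)" by (intro sum_nonneg) auto
    also have "\<dots> = (\<Sum>q\<in>S. pmf \<mu> q * (dist p q)\<^sup>2 - 2 * D * w q + pmf \<mu> q * D\<^sup>2)"
      by (intro sum.cong refl) (simp add: w_def power2_eq_square algebra_simps)
    also have "\<dots> = Q - 2 * D * D + D\<^sup>2"
      using total by (simp add: sum.distrib sum_subtractf sum_distrib_left[symmetric]
          sum_distrib_right[symmetric] Q_def D_def)
    finally show ?thesis by (simp add: power2_eq_square)
  qed
  have c: "0 \<le> 1 - 1 / (12 * real N)" using N by (simp add: field_simps)
  have "IN_ratio \<mu> \<phi> = (norm (\<Sum>q\<in>S. w q *\<^sub>R cis (\<theta> q)))\<^sup>2 / Q"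
    by (simp add: IN_ratio_def fs_integral_def S_def[symmetric] \<phi>_def w_def Q_def)
  also have "\<dots> \<le> (1 - 1 / (12 * real N)) * D\<^sup>2 / Q"
  proof (rule divide_right_mono)
    show "(norm (\<Sum>q\<in>S. w q *\<^sub>R cis (\<theta> q)))\<^sup>2 \<le> (1 - 1 / (12 * real N)) * D\<^sup>2"
      unfolding D_def
      by (rule cis_average_le[where A = A])
        (use fin w0 \<theta>_bounds \<theta>_small heavy mean N in \<open>auto simp: D_def A_def T_def\<close>)
    show "0 \<le> Q" using DQ order_trans[OF zero_le_power2] by blast
  qed
  also have "\<dots> \<le> (1 - 1 / (12 * real N)) * Q / Q"
    using c DQ order_trans[OF zero_le_power2 DQ] by (intro divide_right_mono mult_left_mono)
  also have "\<dots> = 1 - 1 / (12 * real N)"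
  proof -
    have "0 < Q" using zero_less_power[OF D] DQ by (rule less_le_trans)
    then show ?thesis by simp
  qed
  finally have ratio: "IN_ratio \<mu> \<psi> \<le> 1 - 1 / (12 * real N)" using \<psi>(2) by simp
  have "0 \<le> IN_ratio \<mu> \<phi>" for \<phi> :: "'a \<Rightarrow> ell2"
    unfolding IN_ratio_def fs_integral_def by (intro divide_nonneg_nonneg sum_nonneg) auto
  then have "bdd_below {IN_ratio \<mu> \<phi> |\<phi> :: 'a \<Rightarrow> ell2. IN_admissible \<mu> \<phi>}"
    by (intro bdd_belowI[of _ 0]) auto
  then have "IN_delta_measure \<mu> \<le> IN_ratio \<mu> \<psi>"
    unfolding IN_delta_measure_def using \<psi>(1) by (intro cInf_lower) auto
  with ratio show ?thesis by simp
qed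

section \<open>The Izeki--Nayatani invariant of the space\<close>

theorem proposition4p1:
  fixes G :: "('g, 'm) monoid_scheme"
    and \<alpha> :: "'g \<Rightarrow> 'a::metric_space \<Rightarrow> 'a"
  assumes two_points: "\<exists>x y :: 'a. x \<noteq> y"
    and CAT0: "CAT0 TYPE('a)"
    and geodesically_complete: "geodesically_complete TYPE('a)"
    and isometric: "isometric_action G \<alpha>"
    and proper: "proper_action G \<alpha>"
    and cocompact: "cocompact_action G \<alpha>"
  shows "IN_delta TYPE('a) < 1"
proof -
  obtain r N where r: "r > 0" and cball: "\<And>x::'a. compact (cball x r)"
    and cover: "\<And>x::'a. \<exists>F. finite F \<and> card F \<le> N \<and> cball x r \<subseteq> (\<Union>f\<in>F. ball f (r / 8))"
    using uniform_covers[OF isometric proper cocompact] by blast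
  have bound: "IN_delta_measure \<mu> \<le> 1 - 1 / (12 * real N)" if "\<mu> \<in> fs_measures" for \<mu> :: "'a pmf"
  proof -
    obtain F where "finite F" "card F \<le> N"
        "cball (barycenter \<mu>) r \<subseteq> (\<Union>f\<in>F. ball f (r / 8))"
      using cover by blast
    from IN_delta_measure_le[OF CAT0 geodesically_complete that r cball this] show ?thesis .
  qed
  obtain x y :: 'a where "x \<noteq> y" using two_points by blast
  then have "pmf_of_set {x, y} \<in> fs_measures"
    by (simp add: fs_measures_def set_pmf_of_set)
  then have "(fs_measures :: 'a pmf set) \<noteq> {}" by blast
  then have "IN_delta TYPE('a) \<le> 1 - 1 / (12 * real N)"
    unfolding IN_delta_def using bound by (intro cSup_least) auto
  moreover have "0 < N"
  proof -
    obtain F where F: "finite F" "card F \<le> N" "cball x r \<subseteq> (\<Union>f\<in>F. ball f (r / 8))"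
      using cover by blast
    have "x \<in> cball x r" using r by simp
    then have "F \<noteq> {}" using F(3) by blast
    then show ?thesis using F(1,2) card_gt_0_iff[of F] by linarith
  qed
  then have "0 < 1 / (12 * real N)" by simp
  ultimately show ?thesis by linarith
qed

end
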